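(* Let $\Omega\subset\mathbb{R}^3$ with subdomain $\Omega_C$ satisfy the geometry assumption, and let $\chi:\Omega\to\mathbb{R}^{3\times m}$ be a function whose columns belong to $X(\Omega,\Omega_C)$. Let $$X=X_0(\operatorname{curl},\Omega,\Omega_C)\times X_0(\operatorname{curl},\Omega,\Omega_C)'\times\mathbb{R}^m\times\mathbb{R}^m,$$ with dual space identified with $$X'=X_0(\operatorname{curl},\Omega,\Omega_C)'\times X_0(\operatorname{curl},\Omega,\Omega_C)\times\mathbb{R}^m\times\mathbb{R}^m .$$ Then $$\mathcal{D}_{\rm MQS}=\left\{\left(\begin{pmatrix}\boldsymbol{f}_{\boldsymbol{A}}\\\boldsymbol{J}_{\rm int}\\\boldsymbol{v}_{\rm w}\\\boldsymbol{i}\end{pmatrix},\begin{pmatrix}\boldsymbol{J}\\\boldsymbol{E}\\\boldsymbol{i}_{\rm w}\\\boldsymbol{v}\end{pmatrix}\right)\in X\times X'\;:\;\boldsymbol{f}_{\boldsymbol{A}}=\boldsymbol{E},\ \boldsymbol{J}_{\rm int}=-\boldsymbol{J}+\chi\,\boldsymbol{i}_{\rm w},\ \boldsymbol{v}_{\rm w}=-\int_\Omega\chi^\top\boldsymbol{E}\,{\rm d}\xi-\boldsymbol{v},\ \boldsymbol{i}=\boldsymbol{i}_{\rm w}\right\}$$ is a Dirac structure.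
   Context: Geometry assumption: $\Omega\subset\mathbb{R}^3$ is a simply connected bounded Lipschitz domain, decomposed into two Lipschitz regular open subsets $\Omega_C,\Omega_I\subset\Omega$ with $\overline{\Omega}_C\subset\Omega$ and $\Omega_I=\Omega\setminus\overline{\Omega}_C$. $\Omega_C$ is connected, and $\Omega_I$ consists of finitely many connected internal subdomains $\Omega_{I,1},\dots,\Omega_{I,q}$ with single boundary components $\Gamma_1,\dots,\Gamma_q$, respectively, and an external subdomain $\Omega_{I,\rm ext}$ which has two boundary components $\Gamma_{\rm ext}=\overline{\Omega}_{I,\rm ext}\cap\overline{\Omega}_C$ and $\partial\Omega$. Spaces: $X(\Omega,\Omega_C)$ is the set of all functions in $L^2(\Omega;\mathbb{R}^3)$ that are $L^2$-orthogonal to $\nabla\psi$ for all $\psi\in H^1_0(\Omega)$ that are constant on each of $\Gamma_1,\dots,\Gamma_q,\Gamma_{\rm ext}$; it carries the $L^2$ inner product. $H_0(\operatorname{curl},\Omega)$ is the usual space of $L^2$ fields with weak curl in $L^2$ and vanishing tangential trace, and $X_0(\operatorname{curl},\Omega,\Omega_C)=H_0(\operatorname{curl},\Omega)\cap X(\Omega,\Omega_C)$ is a Hilbert space with the $H_0(\operatorname{curl},\Omega)$ inner product; $X_0(\operatorname{curl},\Omega,\Omega_C)'$ is its dual, and the bidual is identified with the space itself by reflexivity. $\mathbb{R}^m$ is identified with its dual. For $\boldsymbol{i}_{\rm w}\in\mathbb{R}^m$, the field $\chi\,\boldsymbol{i}_{\rm w}\in L^2(\Omega;\mathbb{R}^3)$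 is regarded as the element $\boldsymbol{F}\mapsto\int_\Omega\chi\,\boldsymbol{i}_{\rm w}\cdot\boldsymbol{F}\,{\rm d}\xi$ of $X_0(\operatorname{curl},\Omega,\Omega_C)'$. Dirac structure: for a Banach space $X$, a subspace $\mathcal{D}\subset X\times X'$ is a Dirac structure if for all $f\in X$, $e\in X'$: $(f,e)\in\mathcal{D}$ if and only if $\langle f,\hat e\rangle+\langle\hat f,e\rangle=0$ for all $(\hat f,\hat e)\in\mathcal{D}$, where $\langle\cdot,\cdot\rangle$ is the duality pairing of $X$ and $X'$. *)

theory Defs
  imports "HOL-Analysis.Analysis" "HOL-Library.Function_Algebras"
begin

section \<open>Functions as a real vector space\<close>

instantiation "fun" :: (type, real_vector) real_vector
begin

definition scaleR_fun :: "real \<Rightarrow> ('a \<Rightarrow> 'b) \<Rightarrow> 'a \<Rightarrow> 'b" where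
  "scaleR_fun c f = (\<lambda>x. c *\<^sub>R f x)"

instance
  by standard (auto simp: scaleR_fun_def fun_eq_iff scaleR_add_right scaleR_add_left)

end

section \<open>Banach spaces, duals and Dirac structures\<close>

text \<open>
  The spaces below depend on domains and therefore cannot be types. A normed space is a linear
  subspace \<open>V\<close> of a real vector space together with a function \<open>N\<close> that is a norm on \<open>V\<close>; the
  values of \<open>N\<close> outside \<open>V\<close> are irrelevant.
\<close>

definition normed_on :: "'a::real_vector set \<Rightarrow> ('a \<Rightarrow> real) \<Rightarrow> bool" where
  "normed_on V N \<longleftrightarrow> subspace V \<and>
     (\<forall>x\<in>V. 0 \<le> N x \<and> (N x = 0 \<longleftrightarrow> x = 0)) \<and>
     (\<forall>x\<in>V. \<forall>c. N (c *\<^sub>R x) = \<bar>c\<bar> * N x) \<and>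
     (\<forall>x\<in>V. \<forall>y\<in>V. N (x + y) \<le> N x + N y)"

definition banach_on :: "'a::real_vector set \<Rightarrow> ('a \<Rightarrow> real) \<Rightarrow> bool" where
  "banach_on V N \<longleftrightarrow> normed_on V N \<and>
     (\<forall>s. range s \<subseteq> V \<and> (\<forall>\<epsilon>>0. \<exists>k. \<forall>m\<ge>k. \<forall>n\<ge>k. N (s m - s n) < \<epsilon>)
          \<longrightarrow> (\<exists>x\<in>V. (\<lambda>n. N (s n - x)) \<longlonglongrightarrow> 0))"

text \<open>
  Functionals are total functions on the ambient type; they are required to vanish outside \<open>V\<close>
  so that distinct elements of the dual are distinct functions.
\<close>

definition dual :: "'a::real_vector set \<Rightarrow> ('a \<Rightarrow> real) \<Rightarrow> ('a \<Rightarrow> real) set" where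
  "dual V N = {e. (\<forall>x. x \<notin> V \<longrightarrow> e x = 0) \<and>
     (\<forall>x\<in>V. \<forall>y\<in>V. e (x + y) = e x + e y) \<and>
     (\<forall>x\<in>V. \<forall>c. e (c *\<^sub>R x) = c * e x) \<and>
     (\<exists>C. \<forall>x\<in>V. \<bar>e x\<bar> \<le> C * N x)}"

definition dual_norm :: "'a::real_vector set \<Rightarrow> ('a \<Rightarrow> real) \<Rightarrow> ('a \<Rightarrow> real) \<Rightarrow> real" where
  "dual_norm V N e = (SUP x\<in>{x\<in>V. N x \<le> 1}. \<bar>e x\<bar>)"

text \<open>The duality pairing of \<open>f \<in> V\<close> and \<open>e \<in> dual V N\<close> is \<open>e f\<close>.\<close>

definition dirac_structure ::
    "'a::real_vector set \<Rightarrow> ('a \<Rightarrow> real) \<Rightarrow> ('a \<times> ('a \<Rightarrow> real)) set \<Rightarrow> bool" where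
  "dirac_structure V N D \<longleftrightarrow> banach_on V N \<and> subspace D \<and> D \<subseteq> V \<times> dual V N \<and>
     (\<forall>f\<in>V. \<forall>e\<in>dual V N. (f, e) \<in> D \<longleftrightarrow> (\<forall>(f', e')\<in>D. e' f + e f' = 0))"


section \<open>Square integrable fields\<close>

definition square_integrable :: "(real^3 \<Rightarrow> 'b::euclidean_space) \<Rightarrow> bool" where
  "square_integrable f \<longleftrightarrow> f \<in> borel_measurable lebesgue \<and> integrable lebesgue (\<lambda>x. (norm (f x))\<^sup>2)"

lemma square_integrable_zero: "square_integrable (\<lambda>x. 0)"
  by (simp add: square_integrable_def)

lemma square_integrable_add:
  assumes "square_integrable f" "square_integrable g"
  shows "square_integrable (\<lambda>x. f x + g x)"
proof -
  have m: "f \<in> borel_measurable lebesgue" "g \<in> borel_measurable lebesgue"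
    using assms by (auto simp: square_integrable_def)
  have "integrable lebesgue (\<lambda>x. (norm (f x + g x))\<^sup>2)"
  proof (rule Bochner_Integration.integrable_bound)
    show "integrable lebesgue (\<lambda>x. 2 * (norm (f x))\<^sup>2 + 2 * (norm (g x))\<^sup>2)"
      using assms by (auto simp: square_integrable_def)
    have "(norm (f x + g x))\<^sup>2 \<le> 2 * (norm (f x))\<^sup>2 + 2 * (norm (g x))\<^sup>2" for x
    proof -
      have "(norm (f x + g x))\<^sup>2 \<le> (norm (f x) + norm (g x))\<^sup>2"
        by (intro power_mono norm_triangle_ineq) auto
      also have "\<dots> \<le> 2 * (norm (f x))\<^sup>2 + 2 * (norm (g x))\<^sup>2"
        using zero_le_power2[of "norm (f x) - norm (g x)"]
        by (simp add: power2_eq_square algebra_simps)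
      finally show ?thesis .
    qed
    then show "AE x in lebesgue. norm ((norm (f x + g x))\<^sup>2)
        \<le> norm (2 * (norm (f x))\<^sup>2 + 2 * (norm (g x))\<^sup>2)"
      by auto
  qed (use m in measurable)
  then show ?thesis using m by (simp add: square_integrable_def)
qed

lemma square_integrable_scaleR:
  assumes "square_integrable f" shows "square_integrable (\<lambda>x. c *\<^sub>R f x)"
  using assms by (auto simp: square_integrable_def power_mult_distrib)

lemma square_integrable_uminus:
  assumes "square_integrable f" shows "square_integrable (\<lambda>x. - f x)"
  using square_integrable_scaleR[OF assms, of "-1"] by simp

lemma integrable_inner_square_integrable:
  assumes "square_integrable f" "square_integrable g"
  shows "integrable lebesgue (\<lambda>x. f x \<bullet> g x)"
proof (rule Bochner_Integration.integrable_bound)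
  have m: "f \<in> borel_measurable lebesgue" "g \<in> borel_measurable lebesgue"
    using assms by (auto simp: square_integrable_def)
  then show "(\<lambda>x. f x \<bullet> g x) \<in> borel_measurable lebesgue" by measurable
  show "integrable lebesgue (\<lambda>x. (norm (f x))\<^sup>2 + (norm (g x))\<^sup>2)"
    using assms by (auto simp: square_integrable_def)
  have "\<bar>f x \<bullet> g x\<bar> \<le> (norm (f x))\<^sup>2 + (norm (g x))\<^sup>2" for x
  proof -
    have "\<bar>f x \<bullet> g x\<bar> \<le> norm (f x) * norm (g x)" by (rule Cauchy_Schwarz_ineq2)
    moreover have "0 \<le> (norm (f x) - norm (g x))\<^sup>2" "0 \<le> norm (f x) * norm (g x)" by auto
    ultimately show ?thesis by (simp add: power2_eq_square algebra_simps)
  qed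
  then show "AE x in lebesgue. norm (f x \<bullet> g x) \<le> norm ((norm (f x))\<^sup>2 + (norm (g x))\<^sup>2)"
    by auto
qed

text \<open>\<open>'b l2\<close> is the Hilbert space \<open>L\<^sup>2(\<real>\<^sup>3; 'b)\<close> of classes modulo equality almost everywhere.\<close>

quotient_type (overloaded) 'b l2 = "real^3 \<Rightarrow> 'b::euclidean_space" /
  partial: "\<lambda>f g. square_integrable f \<and> square_integrable g \<and> (AE x in lebesgue. f x = g x)"
  morphisms l2_fun l2_of
proof (rule part_equivpI)
  show "\<exists>f::real^3 \<Rightarrow> 'b. square_integrable f \<and> square_integrable f \<and> (AE x in lebesgue. f x = f x)"
    by (rule exI[of _ "\<lambda>x. 0"]) (simp add: square_integrable_zero)
qed (auto intro!: sympI transpI elim: AE_mp)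

instantiation l2 :: (euclidean_space) real_inner
begin

lift_definition zero_l2 :: "'a l2" is "\<lambda>x. 0"
  by (simp add: square_integrable_zero)

lift_definition plus_l2 :: "'a l2 \<Rightarrow> 'a l2 \<Rightarrow> 'a l2" is "\<lambda>f g x. f x + g x"
  by (auto intro: square_integrable_add)

lift_definition uminus_l2 :: "'a l2 \<Rightarrow> 'a l2" is "\<lambda>f x. - f x"
  by (auto intro: square_integrable_uminus)

definition minus_l2 :: "'a l2 \<Rightarrow> 'a l2 \<Rightarrow> 'a l2" where
  "minus_l2 u v = u + - v"

lift_definition scaleR_l2 :: "real \<Rightarrow> 'a l2 \<Rightarrow> 'a l2" is "\<lambda>c f x. c *\<^sub>R f x"
  by (auto intro: square_integrable_scaleR)

lift_definition inner_l2 :: "'a l2 \<Rightarrow> 'a l2 \<Rightarrow> real" is "\<lambda>f g. LINT x|lebesgue. f x \<bullet> g x"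
  apply (rule integral_cong_AE)
    apply (auto simp: square_integrable_def intro: borel_measurable_inner)
  done

definition norm_l2 :: "'a l2 \<Rightarrow> real" where "norm_l2 u = sqrt (inner u u)"
definition dist_l2 :: "'a l2 \<Rightarrow> 'a l2 \<Rightarrow> real" where "dist_l2 u v = norm (u - v)"
definition sgn_l2 :: "'a l2 \<Rightarrow> 'a l2" where "sgn_l2 u = inverse (norm u) *\<^sub>R u"
definition uniformity_l2 :: "('a l2 \<times> 'a l2) filter" where
  "uniformity_l2 = (INF e\<in>{0<..}. principal {(x, y). dist x y < e})"
definition open_l2 :: "'a l2 set \<Rightarrow> bool" where
  "open_l2 U \<longleftrightarrow> (\<forall>x\<in>U. eventually (\<lambda>(x', y). x' = x \<longrightarrow> y \<in> U) uniformity)"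

instance
proof
  fix u v w :: "'a l2" and a b :: real
  show "u + v + w = u + (v + w)"
    by transfer (auto intro!: square_integrable_add simp: add.assoc)
  show "u + v = v + u"
    by transfer (auto intro!: square_integrable_add simp: add.commute)
  show "0 + u = u"
    by transfer (auto intro!: square_integrable_add)
  show "- u + u = 0"
    by transfer (auto intro!: square_integrable_zero square_integrable_add square_integrable_uminus)
  show "u - v = u + - v"
    by (simp add: minus_l2_def)
  show "a *\<^sub>R (u + v) = a *\<^sub>R u + a *\<^sub>R v"
    by transfer (auto intro!: square_integrable_add square_integrable_scaleR simp: scaleR_add_right)
  show "(a + b) *\<^sub>R u = a *\<^sub>R u + b *\<^sub>R u"
    by transfer (auto intro!: square_integrable_add square_integrable_scaleR simp: scaleR_add_left)
  show "a *\<^sub>R b *\<^sub>R u = (a * b) *\<^sub>R u"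
    by transfer (auto intro!: square_integrable_scaleR)
  show "1 *\<^sub>R u = u"
    by transfer (auto intro!: square_integrable_scaleR)
  show "dist u v = norm (u - v)" by (simp add: dist_l2_def)
  show "sgn u = inverse (norm u) *\<^sub>R u" by (simp add: sgn_l2_def)
  show "uniformity = (INF e\<in>{0<..}. principal {(x, y :: 'a l2). dist x y < e})"
    by (simp add: uniformity_l2_def)
  show "open U \<longleftrightarrow> (\<forall>x\<in>U. eventually (\<lambda>(x', y). x' = x \<longrightarrow> y \<in> U) uniformity)"
    for U :: "'a l2 set"
    by (simp add: open_l2_def)
  show "inner u v = inner v u"
    by transfer (simp add: inner_commute)
  show "inner (u + v) w = inner u w + inner v w"
    by transfer (simp add: inner_add_left integrable_inner_square_integrable)
  show "inner (a *\<^sub>R u) v = a * inner u v"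
    by transfer simp
  show "0 \<le> inner u u"
    by transfer (auto intro!: integral_nonneg_AE)
  show "inner u u = 0 \<longleftrightarrow> u = 0"
  proof transfer
    fix f :: "real^3 \<Rightarrow> 'a"
    assume f: "square_integrable f \<and> square_integrable f \<and> (AE x in lebesgue. f x = f x)"
    have "(LINT x|lebesgue. f x \<bullet> f x) = 0 \<longleftrightarrow> (AE x in lebesgue. f x \<bullet> f x = 0)"
      using f by (intro integral_nonneg_eq_0_iff_AE) (auto intro: integrable_inner_square_integrable)
    then show "(LINT x|lebesgue. f x \<bullet> f x) = 0 \<longleftrightarrow>
        square_integrable f \<and> square_integrable (\<lambda>x. 0::'a) \<and> (AE x in lebesgue. f x = 0)"
      using f by (simp add: square_integrable_zero)
  qed
  show "norm u = sqrt (inner u u)" by (simp add: norm_l2_def)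
qed

end

text \<open>\<open>L\<^sup>2(\<Omega>; 'b)\<close> is embedded isometrically into \<open>L\<^sup>2(\<real>\<^sup>3; 'b)\<close> by extension by zero.\<close>

definition L2_on :: "(real^3) set \<Rightarrow> ('b::euclidean_space) l2 set" where
  "L2_on \<Omega> = {u. AE x in lebesgue. x \<notin> \<Omega> \<longrightarrow> l2_fun u x = 0}"


section \<open>Test functions and weak derivatives\<close>

primrec C_k :: "nat \<Rightarrow> ('a::real_normed_vector \<Rightarrow> 'b::real_normed_vector) \<Rightarrow> bool" where
  "C_k 0 f \<longleftrightarrow> continuous_on UNIV f"
| "C_k (Suc k) f \<longleftrightarrow> (\<forall>x. f differentiable (at x)) \<and>
     (\<forall>v. C_k k (\<lambda>x. frechet_derivative f (at x) v))"

definition test_functions ::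
    "(real^3) set \<Rightarrow> (real^3 \<Rightarrow> 'b::euclidean_space) set" where
  "test_functions \<Omega> = {\<phi>. (\<forall>k. C_k k \<phi>) \<and>
     compact (closure {x. \<phi> x \<noteq> 0}) \<and> closure {x. \<phi> x \<noteq> 0} \<subseteq> \<Omega>}"

definition gradient :: "(real^3 \<Rightarrow> real) \<Rightarrow> real^3 \<Rightarrow> real^3" where
  "gradient \<phi> x = (\<chi> i. frechet_derivative \<phi> (at x) (axis i 1))"

definition curl :: "(real^3 \<Rightarrow> real^3) \<Rightarrow> real^3 \<Rightarrow> real^3" where
  "curl \<phi> x = (let J = matrix (frechet_derivative \<phi> (at x)) in
     vector [J$3$2 - J$2$3, J$1$3 - J$3$1, J$2$1 - J$1$2])"

definition has_weak_gradient :: "(real^3) set \<Rightarrow> real l2 \<Rightarrow> (real^3) l2 \<Rightarrow> bool" where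
  "has_weak_gradient \<Omega> \<psi> g \<longleftrightarrow> \<psi> \<in> L2_on \<Omega> \<and> g \<in> L2_on \<Omega> \<and>
     (\<forall>\<phi>\<in>test_functions \<Omega>. \<forall>i.
        inner \<psi> (l2_of (\<lambda>x. gradient \<phi> x $ i)) = - inner g (l2_of (\<lambda>x. axis i (\<phi> x))))"

text \<open>The entry \<open>J $ i $ j\<close> is the weak partial derivative of the \<open>i\<close>-th component along \<open>x\<^sub>j\<close>.\<close>

definition has_weak_jacobian :: "(real^3) set \<Rightarrow> (real^3) l2 \<Rightarrow> (real^3^3) l2 \<Rightarrow> bool" where
  "has_weak_jacobian \<Omega> u J \<longleftrightarrow> u \<in> L2_on \<Omega> \<and> J \<in> L2_on \<Omega> \<and>
     (\<forall>\<phi>\<in>test_functions \<Omega>. \<forall>i j.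
        inner u (l2_of (\<lambda>x. axis i (gradient \<phi> x $ j)))
          = - inner J (l2_of (\<lambda>x. axis i (axis j (\<phi> x)))))"

definition has_weak_curl :: "(real^3) set \<Rightarrow> (real^3) l2 \<Rightarrow> (real^3) l2 \<Rightarrow> bool" where
  "has_weak_curl \<Omega> u w \<longleftrightarrow> u \<in> L2_on \<Omega> \<and> w \<in> L2_on \<Omega> \<and>
     (\<forall>\<phi>\<in>test_functions \<Omega>. inner u (l2_of (curl \<phi>)) = inner w (l2_of \<phi>))"

definition weak_curl :: "(real^3) set \<Rightarrow> (real^3) l2 \<Rightarrow> (real^3) l2" where
  "weak_curl \<Omega> u = (THE w. has_weak_curl \<Omega> u w)"


section \<open>The spaces H(curl) and H0(curl)\<close>

definition H_curl :: "(real^3) set \<Rightarrow> (real^3) l2 set" where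
  "H_curl \<Omega> = {u. \<exists>w. has_weak_curl \<Omega> u w}"

definition H1_vec :: "(real^3) set \<Rightarrow> (real^3) l2 set" where
  "H1_vec \<Omega> = {u. \<exists>J. has_weak_jacobian \<Omega> u J}"

text \<open>
  The tangential trace of \<open>u \<in> H(curl, \<Omega>)\<close> is the functional on \<open>H\<^sup>1(\<Omega>; \<real>\<^sup>3)\<close> given by Green's
  formula; for smooth \<open>u\<close> and \<open>v\<close> it is the boundary integral of \<open>(n \<times> u) \<bullet> v\<close>.
\<close>

definition tangential_trace :: "(real^3) set \<Rightarrow> (real^3) l2 \<Rightarrow> (real^3) l2 \<Rightarrow> real" where
  "tangential_trace \<Omega> u v = inner (weak_curl \<Omega> u) v - inner u (weak_curl \<Omega> v)"

definition H0_curl :: "(real^3) set \<Rightarrow> (real^3) l2 set" where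
  "H0_curl \<Omega> = {u \<in> H_curl \<Omega>. \<forall>v\<in>H1_vec \<Omega>. tangential_trace \<Omega> u v = 0}"

definition H_curl_norm :: "(real^3) set \<Rightarrow> (real^3) l2 \<Rightarrow> real" where
  "H_curl_norm \<Omega> u = sqrt ((norm u)\<^sup>2 + (norm (weak_curl \<Omega> u))\<^sup>2)"


section \<open>Surface measure\<close>

text \<open>
  Surface measure is the two-dimensional Hausdorff measure, obtained by Caratheodory's construction
  from the gauge \<open>\<pi>/4 \<cdot> diam\<^sup>2\<close> on sets of diameter at most \<open>\<delta>\<close>.
\<close>

definition hausdorff_gauge :: "real \<Rightarrow> (real^3) set \<Rightarrow> ennreal" where
  "hausdorff_gauge \<delta> A =
     (if bounded A \<and> diameter A \<le> \<delta> then ennreal (pi / 4 * (diameter A)\<^sup>2) else top)"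

definition hausdorff2 :: "(real^3) set \<Rightarrow> ennreal" where
  "hausdorff2 A = (SUP \<delta>\<in>{0<..}. outer_measure UNIV (hausdorff_gauge \<delta>) A)"

definition surface_measure :: "(real^3) measure" where
  "surface_measure = measure_of UNIV (sets borel) hausdorff2"

text \<open>
  \<open>hausdorff2\<close> is a metric outer measure, so it is countably additive on the Borel sets and
  \<open>measure_of\<close> does not fall back to the zero measure.
\<close>

lemma hausdorff_gauge_empty: "0 < \<delta> \<Longrightarrow> hausdorff_gauge \<delta> {} = 0"
  by (simp add: hausdorff_gauge_def)

lemma hausdorff_gauge_mono: "A \<subseteq> B \<Longrightarrow> hausdorff_gauge \<delta> A \<le> hausdorff_gauge \<delta> B"
  using diameter_subset[of A B] bounded_subset[of B A]
  by (auto simp: hausdorff_gauge_def diameter_ge_0 intro!: ennreal_leI mult_left_mono power_mono)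

lemma hausdorff_gauge_antimono: "\<delta> \<le> \<delta>' \<Longrightarrow> hausdorff_gauge \<delta>' A \<le> hausdorff_gauge \<delta> A"
  by (auto simp: hausdorff_gauge_def)

lemma outer_measure_space_gauge:
  assumes "0 < \<delta>"
  shows "outer_measure_space UNIV (outer_measure UNIV (hausdorff_gauge \<delta>))"
proof -
  interpret sigma_algebra UNIV "Pow (UNIV::(real^3) set)" by (rule sigma_algebra_Pow)
  have "positive UNIV (hausdorff_gauge \<delta>)" "increasing UNIV (hausdorff_gauge \<delta>)"
    using assms by (auto simp: positive_def increasing_def hausdorff_gauge_empty hausdorff_gauge_mono)
  then show ?thesis using outer_measure_space_outer_measure by simp
qed

lemma outer_measure_gauge_le:
  assumes "0 < \<delta>" "X \<subseteq> (\<Union>i. A i)"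
  shows "outer_measure UNIV (hausdorff_gauge \<delta>) X \<le> (\<Sum>i. hausdorff_gauge \<delta> (A i))"
proof -
  interpret sigma_algebra UNIV "Pow (UNIV::(real^3) set)" by (rule sigma_algebra_Pow)
  have "positive UNIV (hausdorff_gauge \<delta>)" "increasing UNIV (hausdorff_gauge \<delta>)"
    using assms by (auto simp: positive_def increasing_def hausdorff_gauge_empty hausdorff_gauge_mono)
  then show ?thesis using outer_measure_le[of "hausdorff_gauge \<delta>" A X] assms by simp
qed

lemma outer_measure_gauge_antimono:
  assumes "\<delta> \<le> \<delta>'"
  shows "outer_measure UNIV (hausdorff_gauge \<delta>') X \<le> outer_measure UNIV (hausdorff_gauge \<delta>) X"
  unfolding outer_measure_def
  by (intro INF_mono) (use assms hausdorff_gauge_antimono in \<open>blast intro: suminf_le summableI\<close>)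

lemma outer_measure_space_hausdorff2: "outer_measure_space UNIV hausdorff2"
  unfolding outer_measure_space_def
proof (intro conjI)
  have *: "positive UNIV (outer_measure UNIV (hausdorff_gauge \<delta>))"
    "increasing UNIV (outer_measure UNIV (hausdorff_gauge \<delta>))"
    "countably_subadditive UNIV (outer_measure UNIV (hausdorff_gauge \<delta>))" if "0 < \<delta>" for \<delta>
    using outer_measure_space_gauge[OF that] by (auto simp: outer_measure_space_def)
  show "positive UNIV hausdorff2"
    unfolding positive_def hausdorff2_def
    using *(1) by (auto simp: positive_def intro!: SUP_eq_const[where I="{0<..}" for I :: "real set"])
  show "increasing UNIV hausdorff2"
    unfolding increasing_def hausdorff2_def
    using *(2) by (auto simp: increasing_def intro!: SUP_subset_mono)
  show "countably_subadditive UNIV hausdorff2"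
    unfolding countably_subadditive_def
  proof (intro allI impI)
    fix A :: "nat \<Rightarrow> (real^3) set"
    assume dis: "disjoint_family A"
    show "hausdorff2 (\<Union>i. A i) \<le> (\<Sum>i. hausdorff2 (A i))"
      unfolding hausdorff2_def[of "\<Union>i. A i"]
    proof (rule SUP_least)
      fix \<delta> :: real assume \<delta>: "\<delta> \<in> {0<..}"
      then have "outer_measure UNIV (hausdorff_gauge \<delta>) (\<Union>i. A i)
          \<le> (\<Sum>i. outer_measure UNIV (hausdorff_gauge \<delta>) (A i))"
        using *(3)[of \<delta>] dis by (auto simp: countably_subadditive_def)
      also have "\<dots> \<le> (\<Sum>i. hausdorff2 (A i))"
        unfolding hausdorff2_def using \<delta> by (intro suminf_le summableI SUP_upper) auto
      finally show "outer_measure UNIV (hausdorff_gauge \<delta>) (\<Union>i. A i) \<le> (\<Sum>i. hausdorff2 (A i))" .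
    qed
  qed
qed

lemma hausdorff2_mono: "A \<subseteq> B \<Longrightarrow> hausdorff2 A \<le> hausdorff2 B"
  using outer_measure_space_hausdorff2 by (auto simp: outer_measure_space_def increasing_def)

lemma hausdorff2_empty: "hausdorff2 {} = 0"
  using outer_measure_space_hausdorff2 by (auto simp: outer_measure_space_def positive_def)

lemma hausdorff2_subadditive: "hausdorff2 (\<Union>i. A i) \<le> (\<Sum>i. hausdorff2 (A i))" for A :: "nat \<Rightarrow> _"
proof -
  have "hausdorff2 (\<Union>i. A i) = hausdorff2 (\<Union>i. disjointed A i)"
    by (simp add: UN_disjointed_eq)
  also have "\<dots> \<le> (\<Sum>i. hausdorff2 (disjointed A i))"
    using outer_measure_space_hausdorff2 disjoint_family_disjointed[of A]
    by (auto simp: outer_measure_space_def countably_subadditive_def)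
  also have "\<dots> \<le> (\<Sum>i. hausdorff2 (A i))"
    by (intro suminf_le summableI hausdorff2_mono disjointed_subset)
  finally show ?thesis .
qed

lemma hausdorff2_Un: "hausdorff2 (A \<union> B) \<le> hausdorff2 A + hausdorff2 B"
proof -
  have "hausdorff2 (A \<union> B) \<le> (\<Sum>i. hausdorff2 (binaryset A B i))"
    using hausdorff2_subadditive[of "binaryset A B"] by (simp add: UN_binaryset_eq)
  also have "\<dots> = hausdorff2 A + hausdorff2 B"
    by (rule suminf_binaryset_eq) (rule hausdorff2_empty)
  finally show ?thesis .
qed

lemma hausdorff2_separated:
  assumes \<epsilon>: "0 < \<epsilon>" and sep: "\<And>a b. a \<in> A \<Longrightarrow> b \<in> B \<Longrightarrow> \<epsilon> \<le> dist a b"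
  shows "hausdorff2 A + hausdorff2 B \<le> hausdorff2 (A \<union> B)"
proof -
  let ?O = "\<lambda>\<delta>. outer_measure UNIV (hausdorff_gauge \<delta>)"
  have step: "?O \<delta> A + ?O \<delta> B \<le> ?O \<delta> (A \<union> B)" if \<delta>: "0 < \<delta>" "\<delta> < \<epsilon>" for \<delta>
    unfolding outer_measure_def[of UNIV _ "A \<union> B"]
  proof (rule INF_greatest, clarify)
    fix C :: "nat \<Rightarrow> (real^3) set" assume C: "A \<union> B \<subseteq> (\<Union>i. C i)"
    have split: "hausdorff_gauge \<delta> (C i \<inter> A) + hausdorff_gauge \<delta> (C i \<inter> B)
        \<le> hausdorff_gauge \<delta> (C i)" for i
    proof (cases "C i \<inter> A = {} \<or> C i \<inter> B = {}")
      case True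
      then show ?thesis
        using \<delta> hausdorff_gauge_empty[of \<delta>] hausdorff_gauge_mono[of "C i \<inter> A" "C i" \<delta>]
          hausdorff_gauge_mono[of "C i \<inter> B" "C i" \<delta>] by auto
    next
      case False
      then obtain a b where ab: "a \<in> C i" "a \<in> A" "b \<in> C i" "b \<in> B" by auto
      have "\<not> (bounded (C i) \<and> diameter (C i) \<le> \<delta>)"
        using diameter_bounded_bound[of "C i" a b] ab sep[of a b] \<delta> by force
      then show ?thesis by (auto simp: hausdorff_gauge_def)
    qed
    have "?O \<delta> A + ?O \<delta> B
        \<le> (\<Sum>i. hausdorff_gauge \<delta> (C i \<inter> A)) + (\<Sum>i. hausdorff_gauge \<delta> (C i \<inter> B))"
      using C \<delta> by (intro add_mono outer_measure_gauge_le) auto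
    also have "\<dots> = (\<Sum>i. hausdorff_gauge \<delta> (C i \<inter> A) + hausdorff_gauge \<delta> (C i \<inter> B))"
      by (rule suminf_add) (auto intro: summableI)
    also have "\<dots> \<le> (\<Sum>i. hausdorff_gauge \<delta> (C i))"
      by (intro suminf_le summableI split)
    finally show "?O \<delta> A + ?O \<delta> B \<le> (\<Sum>i. hausdorff_gauge \<delta> (C i))" .
  qed
  have two: "?O \<delta> A + ?O \<delta>' B \<le> hausdorff2 (A \<union> B)" if "0 < \<delta>" "0 < \<delta>'" for \<delta> \<delta>'
  proof -
    define \<eta> where "\<eta> = min (min \<delta> \<delta>') (\<epsilon> / 2)"
    have \<eta>: "0 < \<eta>" "\<eta> < \<epsilon>" "\<eta> \<le> \<delta>" "\<eta> \<le> \<delta>'" using that \<epsilon> by (auto simp: \<eta>_def)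
    have "?O \<delta> A + ?O \<delta>' B \<le> ?O \<eta> A + ?O \<eta> B"
      using \<eta> by (intro add_mono outer_measure_gauge_antimono)
    also have "\<dots> \<le> ?O \<eta> (A \<union> B)" using \<eta> by (intro step)
    also have "\<dots> \<le> hausdorff2 (A \<union> B)"
      unfolding hausdorff2_def using \<eta> by (intro SUP_upper) auto
    finally show ?thesis .
  qed
  have ne: "{0::real<..} \<noteq> {}" by (auto intro: exI[of _ 1])
  have one: "hausdorff2 A + ?O \<delta>' B \<le> hausdorff2 (A \<union> B)" if "0 < \<delta>'" for \<delta>'
    unfolding hausdorff2_def[of A]
    by (subst ennreal_SUP_add_left[symmetric, OF ne]) (use two that in \<open>auto intro!: SUP_least\<close>)
  have "hausdorff2 A + hausdorff2 B = (SUP \<delta>\<in>{0<..}. hausdorff2 A + ?O \<delta> B)"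
    unfolding hausdorff2_def[of B] by (rule ennreal_SUP_add_right[OF ne])
  also have "\<dots> \<le> hausdorff2 (A \<union> B)" using one by (auto intro!: SUP_least)
  finally show ?thesis .
qed

lemma hausdorff2_separated_sum:
  fixes A :: "nat \<Rightarrow> (real^3) set"
  assumes "\<And>i j. i < j \<Longrightarrow> \<exists>\<epsilon>>0. \<forall>a\<in>A i. \<forall>b\<in>A j. \<epsilon> \<le> dist a b"
  shows "(\<Sum>i<n. hausdorff2 (A i)) \<le> hausdorff2 (\<Union>i<n. A i)"
proof (induction n)
  case 0
  then show ?case by simp
next
  case (Suc n)
  obtain \<epsilon> where \<epsilon>: "\<And>i. i < n \<Longrightarrow> 0 < \<epsilon> i \<and> (\<forall>a\<in>A i. \<forall>b\<in>A n. \<epsilon> i \<le> dist a b)"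
    using assms[of _ n] by metis
  define \<eta> where "\<eta> = Min (insert 1 (\<epsilon> ` {..<n}))"
  have \<eta>: "0 < \<eta>" "\<And>i. i < n \<Longrightarrow> \<eta> \<le> \<epsilon> i" using \<epsilon> by (auto simp: \<eta>_def)
  have "(\<Sum>i<Suc n. hausdorff2 (A i)) \<le> hausdorff2 (\<Union>i<n. A i) + hausdorff2 (A n)"
    using Suc by (simp add: add_mono)
  also have "\<dots> \<le> hausdorff2 ((\<Union>i<n. A i) \<union> A n)"
    by (rule hausdorff2_separated[OF \<eta>(1)]) (use \<epsilon> \<eta>(2) in \<open>force intro: order_trans\<close>)
  also have "(\<Union>i<n. A i) \<union> A n = (\<Union>i<Suc n. A i)" by (auto simp: less_Suc_eq)
  finally show ?case .
qed

lemma hausdorff2_closed_split: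
  fixes F S :: "(real^3) set"
  assumes F: "closed F" "F \<noteq> {}"
  shows "hausdorff2 (S \<inter> F) + hausdorff2 (S - F) \<le> hausdorff2 S"
proof (cases "hausdorff2 S = top")
  case False
  let ?t = "\<lambda>n::nat. 1 / (real n + 1)"
  define A where "A n = {x\<in>S. ?t n \<le> infdist x F}" for n
  define R where "R n = {x\<in>S. ?t (Suc n) \<le> infdist x F \<and> infdist x F < ?t n}" for n
  have lip: "infdist x F - infdist y F \<le> dist x y" for x y
    using infdist_triangle[of x F y] by simp
  have sepR: "\<exists>\<epsilon>>0. \<forall>a\<in>R i. \<forall>b\<in>R j. \<epsilon> \<le> dist a b" if "Suc i < j" for i j
  proof (intro exI[of _ "?t (Suc i) - ?t j"] conjI ballI)
    have "?t j < ?t (Suc i)" using that by (intro divide_strict_left_mono) auto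
    then show "0 < ?t (Suc i) - ?t j" by simp
    fix a b assume "a \<in> R i" "b \<in> R j"
    then show "?t (Suc i) - ?t j \<le> dist a b" using lip[of a b] by (auto simp: R_def)
  qed
  have bound: "(\<Sum>i<n. hausdorff2 (R (2 * i + p))) \<le> hausdorff2 S" for n p
  proof -
    have "(\<Sum>i<n. hausdorff2 (R (2 * i + p))) \<le> hausdorff2 (\<Union>i<n. R (2 * i + p))"
      by (rule hausdorff2_separated_sum) (use sepR in auto)
    also have "\<dots> \<le> hausdorff2 S" by (rule hausdorff2_mono) (auto simp: R_def)
    finally show ?thesis .
  qed
  have double: "(\<Sum>k<2 * n. f k) = (\<Sum>i<n. f (2 * i + 0)) + (\<Sum>i<n. f (2 * i + 1))"
    for n and f :: "nat \<Rightarrow> ennreal"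
    by (induction n) (simp_all add: ac_simps)
  define T where "T = (\<Sum>k. hausdorff2 (R k))"
  have "T \<le> hausdorff2 S + hausdorff2 S"
    unfolding T_def
  proof (rule suminf_le_const[OF summableI])
    fix n
    have "(\<Sum>k<n. hausdorff2 (R k)) \<le> (\<Sum>k<2 * n. hausdorff2 (R k))"
      by (intro sum_mono2) auto
    also have "\<dots> \<le> hausdorff2 S + hausdorff2 S"
      unfolding double by (intro add_mono bound)
    finally show "(\<Sum>k<n. hausdorff2 (R k)) \<le> hausdorff2 S + hausdorff2 S" .
  qed
  also have "\<dots> < top" using False by (simp add: less_top)
  finally have T: "T < top" .
  have far: "hausdorff2 (S \<inter> F) + hausdorff2 (A n) \<le> hausdorff2 S" for n
  proof -
    have "hausdorff2 (S \<inter> F) + hausdorff2 (A n) \<le> hausdorff2 ((S \<inter> F) \<union> A n)"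
    proof (rule hausdorff2_separated)
      show "0 < ?t n" by simp
      fix a b assume "a \<in> S \<inter> F" "b \<in> A n"
      then show "?t n \<le> dist a b"
        using lip[of b a] by (auto simp: A_def dist_commute)
    qed
    also have "\<dots> \<le> hausdorff2 S" by (rule hausdorff2_mono) (auto simp: A_def)
    finally show ?thesis .
  qed
  have cover: "S - F \<subseteq> A n \<union> (\<Union>k. R (k + n))" for n
  proof
    fix x assume x: "x \<in> S - F"
    then have pos: "0 < infdist x F"
      using F by (simp add: infdist_pos_not_in_closed)
    show "x \<in> A n \<union> (\<Union>k. R (k + n))"
    proof (cases "?t n \<le> infdist x F")
      case True
      then show ?thesis using x by (auto simp: A_def)
    next
      case False
      have "\<exists>m. ?t m \<le> infdist x F"
      proof -
        obtain m where "1 / infdist x F < real m" using reals_Archimedean2 by blast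
        then have "?t m \<le> infdist x F" using pos by (simp add: field_simps)
        then show ?thesis ..
      qed
      define m where "m = (LEAST m. ?t m \<le> infdist x F)"
      have m: "?t m \<le> infdist x F"
        unfolding m_def by (rule LeastI_ex) fact
      have nm: "n < m"
      proof (rule ccontr)
        assume "\<not> n < m"
        then have "?t n \<le> ?t m" by (simp add: field_simps)
        then show False using m False by simp
      qed
      then obtain m' where m': "m = Suc m'" by (cases m) auto
      have "\<not> ?t m' \<le> infdist x F"
        using not_less_Least[of m' "\<lambda>m. ?t m \<le> infdist x F"] m' by (simp add: m_def)
      then have "x \<in> R m'" using x m m' by (auto simp: R_def)
      moreover have "m' = (m' - n) + n" using nm m' by simp
      ultimately show ?thesis by (metis UN_I UNIV_I UnI2)
    qed
  qed
  show ?thesis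
  proof (rule ennreal_le_epsilon)
    fix e :: real assume e: "0 < e"
    have "(\<lambda>n. (\<Sum>k<n. hausdorff2 (R k)) + ennreal e) \<longlonglongrightarrow> T + ennreal e"
      unfolding T_def by (intro tendsto_add tendsto_const summable_LIMSEQ summableI)
    moreover have "T < T + ennreal e" using T e by (simp add: ennreal_add_left_cancel_less)
    ultimately have "\<forall>\<^sub>F n in sequentially. T < (\<Sum>k<n. hausdorff2 (R k)) + ennreal e"
      by (rule order_tendstoD(1))
    then obtain n where n: "T < (\<Sum>k<n. hausdorff2 (R k)) + ennreal e"
      by (auto simp: eventually_sequentially)
    have "T = (\<Sum>k<n. hausdorff2 (R k)) + (\<Sum>k. hausdorff2 (R (k + n)))"
      unfolding T_def by (rule trans[OF suminf_offset[OF summableI, of _ n]]) (simp add: add.commute)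
    with n have tail: "(\<Sum>k. hausdorff2 (R (k + n))) < ennreal e"
      by (simp add: ennreal_add_left_cancel_less)
    have "hausdorff2 (S - F) \<le> hausdorff2 (A n) + hausdorff2 (\<Union>k. R (k + n))"
      using cover[of n] by (intro order_trans[OF hausdorff2_mono hausdorff2_Un])
    also have "\<dots> \<le> hausdorff2 (A n) + ennreal e"
      using tail hausdorff2_subadditive[of "\<lambda>k. R (k + n)"] by (intro add_left_mono) auto
    finally have "hausdorff2 (S \<inter> F) + hausdorff2 (S - F)
        \<le> (hausdorff2 (S \<inter> F) + hausdorff2 (A n)) + ennreal e"
      by (simp add: add_left_mono add.assoc)
    also have "\<dots> \<le> hausdorff2 S + ennreal e" by (intro add_right_mono far)
    finally show "hausdorff2 (S \<inter> F) + hausdorff2 (S - F) \<le> hausdorff2 S + ennreal e" .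
  qed
qed simp

lemma measure_space_hausdorff2: "measure_space UNIV (sets borel) hausdorff2"
proof -
  interpret P: sigma_algebra UNIV "Pow (UNIV::(real^3) set)" by (rule sigma_algebra_Pow)
  let ?L = "lambda_system UNIV (Pow UNIV) hausdorff2"
  have L: "measure_space UNIV ?L hausdorff2"
    using P.caratheodory_lemma[of hausdorff2] outer_measure_space_hausdorff2 by simp
  then have sa: "sigma_algebra UNIV ?L" by (simp add: measure_space_def)
  have "closed F \<Longrightarrow> F \<in> ?L" for F
  proof (cases "F = {}")
    case True
    have "positive UNIV hausdorff2"
      using outer_measure_space_hausdorff2 by (simp add: outer_measure_space_def)
    then show ?thesis using True P.lambda_system_empty[of hausdorff2] by simp
  next
    case False
    assume F: "closed F"
    have "hausdorff2 (S \<inter> F) + hausdorff2 (S - F) = hausdorff2 S" for S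
      using hausdorff2_closed_split[OF F False, of S] hausdorff2_Un[of "S \<inter> F" "S - F"]
      by (simp add: Int_Diff_Un antisym)
    moreover have "(UNIV - F) \<inter> S = S - F" for S by auto
    ultimately show ?thesis by (simp add: lambda_system_def Int_commute)
  qed
  then have "sigma_sets UNIV (Collect closed) \<subseteq> ?L"
    by (intro sigma_algebra.sigma_sets_subset[OF sa]) auto
  then have "sets (borel::(real^3) measure) \<subseteq> ?L"
    by (simp add: borel_eq_closed)
  then show ?thesis
    using L sets.sigma_algebra_axioms[of "borel::(real^3) measure"] by (auto intro: measure_down)
qed

lemma emeasure_surface_measure:
  "A \<in> sets borel \<Longrightarrow> emeasure surface_measure A = hausdorff2 A"
  unfolding surface_measure_def
  using measure_space_hausdorff2
  by (intro emeasure_measure_of_sigma) (auto simp: measure_space_def)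

section \<open>The space X and traces on the interfaces\<close>

text \<open>
  Convergence in \<open>H\<^sup>1(\<Omega>)\<close> of test functions \<open>\<phi> n\<close> to \<open>\<psi>\<close>, where \<open>g\<close> is the limit of the gradients.
\<close>

definition H1_tendsto :: "(real^3) set \<Rightarrow> (nat \<Rightarrow> real^3 \<Rightarrow> real) \<Rightarrow> real l2 \<Rightarrow> bool" where
  "H1_tendsto \<Omega> \<phi> \<psi> \<longleftrightarrow> (\<exists>g. has_weak_gradient \<Omega> \<psi> g \<and>
     (\<lambda>n. l2_of (\<phi> n)) \<longlonglongrightarrow> \<psi> \<and> (\<lambda>n. l2_of (gradient (\<phi> n))) \<longlonglongrightarrow> g)"

definition H1_0 :: "(real^3) set \<Rightarrow> real l2 set" where
  "H1_0 \<Omega> = {\<psi>. \<exists>\<phi>. (\<forall>n. \<phi> n \<in> test_functions \<Omega>) \<and> H1_tendsto \<Omega> \<phi> \<psi>}"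

text \<open>
  The trace operator \<open>H\<^sup>1\<^sub>0(\<Omega>) \<rightarrow> L\<^sup>2(\<Gamma>)\<close> on a surface \<open>\<Gamma>\<close> inside \<open>\<Omega>\<close> is the continuous extension
  of the restriction of test functions; \<open>h\<close> below represents the trace of \<open>\<psi>\<close>.
\<close>

definition has_trace ::
    "(real^3) set \<Rightarrow> (real^3) set \<Rightarrow> real l2 \<Rightarrow> (real^3 \<Rightarrow> real) \<Rightarrow> bool" where
  "has_trace \<Omega> \<Gamma> \<psi> h \<longleftrightarrow> (\<exists>\<phi>. (\<forall>n. \<phi> n \<in> test_functions \<Omega>) \<and> H1_tendsto \<Omega> \<phi> \<psi> \<and>
     (\<lambda>n. \<integral>\<^sup>+x\<in>\<Gamma>. ennreal ((\<phi> n x - h x)\<^sup>2) \<partial>surface_measure) \<longlonglongrightarrow> 0)"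

text \<open>\<open>\<G>\<close> is the set of interfaces on which the potentials have to be constant.\<close>

definition X_space :: "(real^3) set \<Rightarrow> (real^3) set set \<Rightarrow> (real^3) l2 set" where
  "X_space \<Omega> \<G> = {u \<in> L2_on \<Omega>. \<forall>\<psi> g. \<psi> \<in> H1_0 \<Omega> \<and> has_weak_gradient \<Omega> \<psi> g \<and>
     (\<forall>\<Gamma>\<in>\<G>. \<exists>c. has_trace \<Omega> \<Gamma> \<psi> (\<lambda>x. c)) \<longrightarrow> inner u g = 0}"

definition X0_curl :: "(real^3) set \<Rightarrow> (real^3) set set \<Rightarrow> (real^3) l2 set" where
  "X0_curl \<Omega> \<G> = H0_curl \<Omega> \<inter> X_space \<Omega> \<G>"


section \<open>Geometry\<close>

text \<open>
  After a rigid change of coordinates the set lies, near each boundary point, strictly above the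
  graph of a Lipschitz function.
\<close>

definition lipschitz_boundary :: "(real^3) set \<Rightarrow> bool" where
  "lipschitz_boundary S \<longleftrightarrow> (\<forall>x\<in>frontier S. \<exists>r>0. \<exists>T::real^3 \<Rightarrow> real^3. orthogonal_transformation T \<and>
     (\<exists>(\<gamma>::real^2 \<Rightarrow> real) L. L-lipschitz_on UNIV \<gamma> \<and>
        S \<inter> ball x r = {y \<in> ball x r. \<gamma> (vector [T y $ 1, T y $ 2]) < T y $ 3}))"

definition geometry_assumption ::
    "(real^3) set \<Rightarrow> (real^3) set \<Rightarrow> nat \<Rightarrow> (nat \<Rightarrow> (real^3) set) \<Rightarrow> (real^3) set
     \<Rightarrow> (nat \<Rightarrow> (real^3) set) \<Rightarrow> (real^3) set \<Rightarrow> bool" where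
  "geometry_assumption \<Omega> \<Omega>C q \<Omega>I \<Omega>E \<Gamma> \<Gamma>E \<longleftrightarrow>
     open \<Omega> \<and> bounded \<Omega> \<and> connected \<Omega> \<and> simply_connected \<Omega> \<and> lipschitz_boundary \<Omega> \<and>
     open \<Omega>C \<and> connected \<Omega>C \<and> lipschitz_boundary \<Omega>C \<and> closure \<Omega>C \<subseteq> \<Omega> \<and>
     lipschitz_boundary (\<Omega> - closure \<Omega>C) \<and>
     components (\<Omega> - closure \<Omega>C) = insert \<Omega>E (\<Omega>I ` {1..q}) \<and>
     inj_on \<Omega>I {1..q} \<and> \<Omega>E \<notin> \<Omega>I ` {1..q} \<and>
     (\<forall>k\<in>{1..q}. components (frontier (\<Omega>I k)) = {\<Gamma> k}) \<and>
     \<Gamma>E = closure \<Omega>E \<inter> closure \<Omega>C \<and>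
     \<Gamma>E \<noteq> frontier \<Omega> \<and> components (frontier \<Omega>E) = {\<Gamma>E, frontier \<Omega>}"


section \<open>The MQS structure\<close>

text \<open>
  In this section \<open>V\<close> is \<open>X0_curl \<Omega> \<G>\<close> and \<open>N\<close> is \<open>H_curl_norm \<Omega>\<close>. The product
  \<open>V \<times> V' \<times> \<real>\<^sup>m \<times> \<real>\<^sup>m\<close> carries the Euclidean product norm.
\<close>

definition product_space ::
    "'a::real_vector set \<Rightarrow> ('a \<Rightarrow> real) \<Rightarrow> ('a \<times> ('a \<Rightarrow> real) \<times> (real^'m) \<times> (real^'m)) set" where
  "product_space V N = V \<times> dual V N \<times> UNIV \<times> UNIV"

definition product_norm ::
    "'a::real_vector set \<Rightarrow> ('a \<Rightarrow> real) \<Rightarrow> 'a \<times> ('a \<Rightarrow> real) \<times> (real^'m) \<times> (real^'m) \<Rightarrow> real" where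
  "product_norm V N = (\<lambda>(a, b, c, d).
     sqrt ((N a)\<^sup>2 + (dual_norm V N b)\<^sup>2 + (norm c)\<^sup>2 + (norm d)\<^sup>2))"

text \<open>
  The identification of \<open>V' \<times> V \<times> \<real>\<^sup>m \<times> \<real>\<^sup>m\<close> with the dual of \<open>V \<times> V' \<times> \<real>\<^sup>m \<times> \<real>\<^sup>m\<close>, in which
  an element of \<open>V\<close> acts on \<open>V'\<close> by evaluation.
\<close>

definition to_dual ::
    "'a::real_vector set \<Rightarrow> ('a \<Rightarrow> real) \<Rightarrow> ('a \<Rightarrow> real) \<times> 'a \<times> (real^'m) \<times> (real^'m)
     \<Rightarrow> 'a \<times> ('a \<Rightarrow> real) \<times> (real^'m) \<times> (real^'m) \<Rightarrow> real" where
  "to_dual V N = (\<lambda>(J, E, i\<^sub>w, v) (a, b, c, d).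
     if (a, b, c, d) \<in> product_space V N then J a + b E + c \<bullet> i\<^sub>w + d \<bullet> v else 0)"

text \<open>The field \<open>chi i\<close>, for a \<open>3 \<times> m\<close> matrix field \<open>chi\<close>, as an element of \<open>V'\<close>.\<close>

definition winding_functional ::
    "(real^3) set \<Rightarrow> (real^3) l2 set \<Rightarrow> (real^3 \<Rightarrow> real^'m^3) \<Rightarrow> (real^'m) \<Rightarrow> (real^3) l2 \<Rightarrow> real" where
  "winding_functional \<Omega> V chi i =
     (\<lambda>F. if F \<in> V then LINT x:\<Omega>|lebesgue. (chi x *v i) \<bullet> l2_fun F x else 0)"

definition D_MQS ::
    "(real^3) set \<Rightarrow> (real^3) l2 set \<Rightarrow> ((real^3) l2 \<Rightarrow> real) \<Rightarrow> (real^3 \<Rightarrow> real^'m^3)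
     \<Rightarrow> (((real^3) l2 \<times> ((real^3) l2 \<Rightarrow> real) \<times> (real^'m) \<times> (real^'m))
       \<times> ((real^3) l2 \<times> ((real^3) l2 \<Rightarrow> real) \<times> (real^'m) \<times> (real^'m) \<Rightarrow> real)) set" where
  "D_MQS \<Omega> V N chi =
     {((f\<^sub>A, J\<^sub>i\<^sub>n\<^sub>t, v\<^sub>w, i), to_dual V N (J, E, i\<^sub>w, v)) | f\<^sub>A J\<^sub>i\<^sub>n\<^sub>t v\<^sub>w i J E i\<^sub>w v.
        f\<^sub>A \<in> V \<and> J\<^sub>i\<^sub>n\<^sub>t \<in> dual V N \<and> J \<in> dual V N \<and> E \<in> V \<and>
        f\<^sub>A = E \<and>
        J\<^sub>i\<^sub>n\<^sub>t = - J + winding_functional \<Omega> V chi i\<^sub>w \<and>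
        v\<^sub>w = - (LINT x:\<Omega>|lebesgue. transpose (chi x) *v l2_fun E x) - v \<and>
        i = i\<^sub>w}"

end

theory Submission
  imports Defs
begin

text \<open>
  Once \<open>V\<close> is known to be a Hilbert space it is reflexive, so every functional on the product is
  of the form \<open>(J, E, i\<^sub>w, v)\<close>. The map taking these to the flows \<open>(E, - J + \<chi> i\<^sub>w, - \<integral>\<chi>\<^sup>\<top> E - v, i\<^sub>w)\<close>
  is skew-adjoint, because \<open>i\<^sub>w \<mapsto> \<chi> i\<^sub>w\<close> and \<open>E \<mapsto> \<integral>\<chi>\<^sup>\<top> E\<close> are adjoint to each other, and its graph is
  a Dirac structure: testing the pairing against \<open>J'\<close>, \<open>v'\<close>, \<open>i\<^sub>w'\<close> and \<open>E'\<close> separately recovers the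
  four defining equations.

  \<open>V\<close> is a Hilbert space because \<open>u \<mapsto> (u, curl u)\<close> maps it isometrically onto a closed subspace of
  \<open>L\<^sup>2 \<times> L\<^sup>2\<close>. This uses the completeness of \<open>L\<^sup>2\<close> (Riesz-Fischer) and the uniqueness of the weak
  curl, that is, the fundamental lemma of the calculus of variations.
\<close>

section \<open>Completeness of the space of square integrable fields\<close>

lemma square_integrable_l2_fun: "square_integrable (l2_fun u)"
  using Quotient_rep_reflp[OF Quotient_l2, of u] by simp

lemma l2_fun_l2_of: "square_integrable f \<Longrightarrow> AE x in lebesgue. l2_fun (l2_of f) x = f x"
  using Quotient_rep_abs[OF Quotient_l2, of f] by simp

lemma l2_of_l2_fun [simp]: "l2_of (l2_fun u) = u"
  using Quotient_abs_rep[OF Quotient_l2] .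

lemma l2_eqI: "(AE x in lebesgue. l2_fun u x = l2_fun v x) \<Longrightarrow> u = v"
  using Quotient_rel_rep[OF Quotient_l2, of u v] by (simp add: square_integrable_l2_fun)

lemma l2_fun_measurable [measurable]: "l2_fun u \<in> borel_measurable lebesgue"
  using square_integrable_l2_fun[of u] by (simp add: square_integrable_def)

lemma l2_fun_add: "AE x in lebesgue. l2_fun (u + v) x = l2_fun u x + l2_fun v x"
proof -
  have "u + v = l2_of (\<lambda>x. l2_fun u x + l2_fun v x)"
    by (simp add: plus_l2_def)
  then show ?thesis
    by (simp add: l2_fun_l2_of square_integrable_add square_integrable_l2_fun)
qed

lemma l2_fun_scaleR: "AE x in lebesgue. l2_fun (c *\<^sub>R u) x = c *\<^sub>R l2_fun u x"
proof -
  have "c *\<^sub>R u = l2_of (\<lambda>x. c *\<^sub>R l2_fun u x)"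
    by (simp add: scaleR_l2_def)
  then show ?thesis
    by (simp add: l2_fun_l2_of square_integrable_scaleR square_integrable_l2_fun)
qed

lemma l2_fun_zero: "AE x in lebesgue. l2_fun 0 x = 0"
  using l2_fun_scaleR[of 0 0] by simp

lemma l2_fun_diff: "AE x in lebesgue. l2_fun (u - v) x = l2_fun u x - l2_fun v x"
  using l2_fun_add[of u "- v"] l2_fun_scaleR[of "- 1" v] by eventually_elim simp

lemma inner_l2_eq: "u \<bullet> v = (LINT x|lebesgue. l2_fun u x \<bullet> l2_fun v x)"
  by (simp add: inner_l2_def)

lemma inner_l2_of_right:
  assumes "square_integrable f"
  shows "u \<bullet> l2_of f = (LINT x|lebesgue. l2_fun u x \<bullet> f x)"
proof -
  have [measurable]: "f \<in> borel_measurable lebesgue"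
    using assms by (simp add: square_integrable_def)
  show ?thesis
    unfolding inner_l2_eq using l2_fun_l2_of[OF assms]
    by (intro integral_cong_AE) (auto elim: AE_mp)
qed

lemma norm_l2_of:
  assumes "square_integrable f"
  shows "ennreal ((norm (l2_of f))\<^sup>2) = (\<integral>\<^sup>+x. ennreal ((norm (f x))\<^sup>2) \<partial>lebesgue)"
proof -
  have m [measurable]: "f \<in> borel_measurable lebesgue"
    and i: "integrable lebesgue (\<lambda>x. (norm (f x))\<^sup>2)"
    using assms by (simp_all add: square_integrable_def)
  have "(norm (l2_of f))\<^sup>2 = (LINT x|lebesgue. l2_fun (l2_of f) x \<bullet> f x)"
    by (simp add: power2_norm_eq_inner inner_l2_of_right[OF assms])
  also have "\<dots> = (LINT x|lebesgue. (norm (f x))\<^sup>2)"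
    using l2_fun_l2_of[OF assms]
    by (intro integral_cong_AE) (auto elim: AE_mp simp: power2_norm_eq_inner)
  finally show ?thesis
    using i by (simp add: nn_integral_eq_integral)
qed

lemma norm_l2_diff:
  "ennreal ((norm (u - v))\<^sup>2) = (\<integral>\<^sup>+x. ennreal ((norm (l2_fun u x - l2_fun v x))\<^sup>2) \<partial>lebesgue)"
proof -
  have "ennreal ((norm (u - v))\<^sup>2) = (\<integral>\<^sup>+x. ennreal ((norm (l2_fun (u - v) x))\<^sup>2) \<partial>lebesgue)"
    using norm_l2_of[OF square_integrable_l2_fun, of "u - v"] by simp
  also have "\<dots> = (\<integral>\<^sup>+x. ennreal ((norm (l2_fun u x - l2_fun v x))\<^sup>2) \<partial>lebesgue)"
    using l2_fun_diff[of u v] by (intro nn_integral_cong_AE) (auto elim: AE_mp)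
  finally show ?thesis .
qed

section \<open>The Riesz-Fischer theorem\<close>

text \<open>At almost every point the telescoping series of increments converges absolutely: the
  geometric decay of the norms makes a weighted sum of the squared increments integrable, hence
  finite almost everywhere.\<close>

lemma l2_fast_Cauchy_AE_convergent:
  fixes Y :: "nat \<Rightarrow> 'b::euclidean_space l2"
  assumes Y: "\<And>k. norm (Y (Suc k) - Y k) \<le> (1/2) ^ k"
  shows "AE x in lebesgue. convergent (\<lambda>k. l2_fun (Y k) x)"
proof -
  define d where "d k x = norm (l2_fun (Y (Suc k)) x - l2_fun (Y k) x)" for k x
  have [measurable]: "d k \<in> borel_measurable lebesgue" for k
    unfolding d_def by measurable
  \<comment> \<open>The weights make \<open>d k x \<le> 2 ^ k * (d k x)\<^sup>2 + (1/2) ^ k\<close> summable almost everywhere without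
    Minkowski's inequality.\<close>
  have "(\<integral>\<^sup>+x. (\<Sum>k. ennreal (2 ^ k * (d k x)\<^sup>2)) \<partial>lebesgue)
      = (\<Sum>k. \<integral>\<^sup>+x. ennreal (2 ^ k * (d k x)\<^sup>2) \<partial>lebesgue)"
    by (rule nn_integral_suminf) measurable
  also have "\<dots> \<le> (\<Sum>k. ennreal ((1/2) ^ k))"
  proof (intro suminf_le summableI)
    fix k
    have "(\<integral>\<^sup>+x. ennreal (2 ^ k * (d k x)\<^sup>2) \<partial>lebesgue)
        = ennreal (2 ^ k) * ennreal ((norm (Y (Suc k) - Y k))\<^sup>2)"
      by (simp add: norm_l2_diff ennreal_mult nn_integral_cmult flip: d_def)
    also have "\<dots> \<le> ennreal (2 ^ k) * ennreal (((1/2) ^ k)\<^sup>2)"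
      using Y[of k] by (intro mult_left_mono ennreal_leI power_mono) auto
    also have "\<dots> = ennreal ((1/2) ^ k)"
      by (simp add: power2_eq_square power_one_over flip: ennreal_mult)
    finally show "(\<integral>\<^sup>+x. ennreal (2 ^ k * (d k x)\<^sup>2) \<partial>lebesgue) \<le> ennreal ((1/2) ^ k)" .
  qed
  also have "\<dots> < \<infinity>"
    by (subst suminf_ennreal2) auto
  finally have "(\<integral>\<^sup>+x. (\<Sum>k. ennreal (2 ^ k * (d k x)\<^sup>2)) \<partial>lebesgue) \<noteq> \<infinity>" by simp
  then have "AE x in lebesgue. (\<Sum>k. ennreal (2 ^ k * (d k x)\<^sup>2)) \<noteq> \<infinity>"
    by (intro nn_integral_PInf_AE) measurable
  then show ?thesis
  proof eventually_elim
    fix x assume "(\<Sum>k. ennreal (2 ^ k * (d k x)\<^sup>2)) \<noteq> \<infinity>"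
    then have s: "summable (\<lambda>k. 2 ^ k * (d k x)\<^sup>2)"
      by (intro summable_suminf_not_top) auto
    have "d k x \<le> 2 ^ k * (d k x)\<^sup>2 + (1/2) ^ k" for k
    \<comment> \<open>Either the increment is below the geometric term, or
      \<open>2 ^ k * d k x\<close> is at least 1 and multiplying by \<open>d k x\<close> gives the
      quadratic term.\<close>
    proof (cases "d k x \<le> (1/2) ^ k")
      case False
      then have "1 \<le> 2 ^ k * d k x" by (simp add: field_simps power_one_over)
      then have "1 * d k x \<le> (2 ^ k * d k x) * d k x"
        by (intro mult_right_mono) (auto simp: d_def)
      then show ?thesis
        by (simp add: power2_eq_square mult.assoc add_increasing2)
    qed (simp add: add_increasing)
    then have "summable (\<lambda>k. d k x)"
      by (intro summable_comparison_test'[OF summable_add[OF s summable_geometric[of "1/2::real"]],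
            of 0]) (auto simp: d_def)
    then have "summable (\<lambda>k. l2_fun (Y (Suc k)) x - l2_fun (Y k) x)"
      unfolding d_def by (rule summable_norm_cancel)
    then have "convergent (\<lambda>n. \<Sum>k<n. l2_fun (Y (Suc k)) x - l2_fun (Y k) x)"
      by (simp add: summable_iff_convergent)
    then have "convergent (\<lambda>n. l2_fun (Y n) x - l2_fun (Y 0) x)"
      by (subst (asm) sum_lessThan_telescope)
    from convergent_add[OF this convergent_const[of "l2_fun (Y 0) x"]]
    show "convergent (\<lambda>k. l2_fun (Y k) x)" by simp
  qed
qed

text \<open>The limit is the pointwise one; Fatou's lemma, applied in \<open>n\<close> with
  \<open>k\<close> fixed, carries the norm bound over to it.\<close>

lemma l2_fast_Cauchy_limit:
  fixes Y :: "nat \<Rightarrow> 'b::euclidean_space l2"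
  assumes Y: "\<And>k n. k \<le> n \<Longrightarrow> norm (Y n - Y k) \<le> (1/2) ^ k"
  shows "\<exists>u. \<forall>k. norm (u - Y k) \<le> (1/2) ^ k"
proof -
  \<comment> \<open>On the null set where the representatives diverge \<open>lim\<close> has an
    unspecified value, which no integral sees.\<close>
  define f where "f x = lim (\<lambda>k. l2_fun (Y k) x)" for x
  have [measurable]: "f \<in> borel_measurable lebesgue"
    unfolding f_def by measurable
  have lim: "AE x in lebesgue. (\<lambda>k. l2_fun (Y k) x) \<longlonglongrightarrow> f x"
    using l2_fast_Cauchy_AE_convergent[of Y] Y by (auto simp: f_def convergent_LIMSEQ_iff)
  have bound: "(\<integral>\<^sup>+x. ennreal ((norm (f x - l2_fun (Y k) x))\<^sup>2) \<partial>lebesgue) \<le> ennreal (((1/2) ^ k)\<^sup>2)"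
    for k
  proof -
    have "(\<integral>\<^sup>+x. ennreal ((norm (f x - l2_fun (Y k) x))\<^sup>2) \<partial>lebesgue)
        = (\<integral>\<^sup>+x. liminf (\<lambda>n. ennreal ((norm (l2_fun (Y n) x - l2_fun (Y k) x))\<^sup>2)) \<partial>lebesgue)"
    proof (rule nn_integral_cong_AE)
      show "AE x in lebesgue. ennreal ((norm (f x - l2_fun (Y k) x))\<^sup>2)
          = liminf (\<lambda>n. ennreal ((norm (l2_fun (Y n) x - l2_fun (Y k) x))\<^sup>2))"
        using lim
      proof eventually_elim
        fix x assume "(\<lambda>k. l2_fun (Y k) x) \<longlonglongrightarrow> f x"
        then have "(\<lambda>n. ennreal ((norm (l2_fun (Y n) x - l2_fun (Y k) x))\<^sup>2))
            \<longlonglongrightarrow> ennreal ((norm (f x - l2_fun (Y k) x))\<^sup>2)"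
          by (intro tendsto_intros)
        then show "ennreal ((norm (f x - l2_fun (Y k) x))\<^sup>2)
          = liminf (\<lambda>n. ennreal ((norm (l2_fun (Y n) x - l2_fun (Y k) x))\<^sup>2))"
          by (metis lim_imp_Liminf trivial_limit_sequentially)
      qed
    qed
    also have "\<dots> \<le> liminf (\<lambda>n. \<integral>\<^sup>+x. ennreal ((norm (l2_fun (Y n) x - l2_fun (Y k) x))\<^sup>2) \<partial>lebesgue)"
      by (rule nn_integral_liminf) measurable
    also have "\<dots> = liminf (\<lambda>n. ennreal ((norm (Y n - Y k))\<^sup>2))"
      by (simp add: norm_l2_diff)
    also have "\<dots> \<le> ennreal (((1/2) ^ k)\<^sup>2)"
    proof -
      have "\<forall>\<^sub>F n in sequentially. ennreal ((norm (Y n - Y k))\<^sup>2) \<le> ennreal (((1/2) ^ k)\<^sup>2)"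
        using eventually_ge_at_top[of k]
        by eventually_elim (intro ennreal_leI power_mono Y, auto)
      then show ?thesis
        by (intro Liminf_le) auto
    qed
    finally show ?thesis .
  qed
  \<comment> \<open>Fatou bounds only differences, so the square integrability of \<open>f\<close>
    itself is recovered by adding \<open>Y 0\<close> back.\<close>
  have diff: "square_integrable (\<lambda>x. f x - l2_fun (Y k) x)" for k
    unfolding square_integrable_def
  proof
    show "integrable lebesgue (\<lambda>x. (norm (f x - l2_fun (Y k) x))\<^sup>2)"
      using bound[of k] by (intro integrableI_nonneg) (auto intro: le_less_trans)
  qed measurable
  have f: "square_integrable f"
    using square_integrable_add[OF diff[of 0] square_integrable_l2_fun[of "Y 0"]] by simp
  have "norm (l2_of f - Y k) \<le> (1/2) ^ k" for k
  proof -
    have "ennreal ((norm (l2_of f - Y k))\<^sup>2) = (\<integral>\<^sup>+x. ennreal ((norm (f x - l2_fun (Y k) x))\<^sup>2) \<partial>lebesgue)"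
      unfolding norm_l2_diff using l2_fun_l2_of[OF f]
      by (intro nn_integral_cong_AE) (auto elim: AE_mp)
    also note bound
    finally have "(norm (l2_of f - Y k))\<^sup>2 \<le> ((1/2) ^ k)\<^sup>2" by simp
    then show ?thesis by (rule power2_le_imp_le) simp
  qed
  then show ?thesis by blast
qed

instance l2 :: (euclidean_space) complete_space
proof
  fix X :: "nat \<Rightarrow> 'a l2" assume X: "Cauchy X"
  have "\<forall>k. \<exists>M. \<forall>m\<ge>M. \<forall>n\<ge>M. norm (X m - X n) < (1/2) ^ k"
    using X by (auto simp: Cauchy_iff)
  then obtain M where M: "\<And>k m n. m \<ge> M k \<Longrightarrow> n \<ge> M k \<Longrightarrow> norm (X m - X n) < (1/2) ^ k"
    by metis
  \<comment> \<open>Summing the thresholds makes \<open>r\<close> monotone while keeping it above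
    \<open>M k\<close>, so \<open>r n\<close> with \<open>k \<le> n\<close> also lies beyond
    \<open>M k\<close> and the subsequence is fast Cauchy.\<close>
  define r where "r k = (\<Sum>j\<le>k. M j)" for k
  have rM: "M k \<le> r k" for k
    unfolding r_def by (rule member_le_sum) auto
  have mono: "k \<le> n \<Longrightarrow> r k \<le> r n" for k n
    unfolding r_def by (intro sum_mono2) auto
  have "norm (X (r n) - X (r k)) \<le> (1/2) ^ k" if "k \<le> n" for k n
    using M[of k "r n" "r k"] rM[of k] mono[OF that] by simp
  then obtain u where u: "\<And>k. norm (u - X (r k)) \<le> (1/2) ^ k"
    using l2_fast_Cauchy_limit[of "\<lambda>k. X (r k)"] by blast
  have "X \<longlonglongrightarrow> u"
  proof (rule LIMSEQ_I)
    fix e :: real assume "0 < e"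
    then obtain k where k: "(1/2) ^ k < e / 2"
      using real_arch_pow_inv[of "e / 2" "1/2"] by auto
    have "norm (X n - u) < e" if "n \<ge> M k" for n
    proof -
      have "norm (X n - u) \<le> norm (X n - X (r k)) + norm (u - X (r k))"
        using norm_triangle_ineq4[of "X n - X (r k)" "u - X (r k)"] by simp
      then show ?thesis
        using M[OF that rM] u[of k] k by linarith
    qed
    then show "\<exists>M. \<forall>n\<ge>M. norm (X n - u) < e" by blast
  qed
  then show "convergent X" by (rule convergentI)
qed

section \<open>Smooth bump functions\<close>

lemma C_k_SucD: "C_k (Suc k) f \<Longrightarrow> C_k k f"
proof (induction k arbitrary: f)
  case 0
  then show ?case
    by (auto intro!: differentiable_imp_continuous_on simp: differentiable_on_def)
qed simp

lemma C_k_const: "C_k k (\<lambda>x. c)"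
  by (induction k arbitrary: c) auto

lemma C_k_add: "C_k k f \<Longrightarrow> C_k k g \<Longrightarrow> C_k k (\<lambda>x. f x + g x)"
proof (induction k arbitrary: f g)
  case (Suc k)
  have "frechet_derivative (\<lambda>x. f x + g x) (at x)
      = (\<lambda>v. frechet_derivative f (at x) v + frechet_derivative g (at x) v)" for x
    using Suc.prems
    by (intro frechet_derivative_at[symmetric] has_derivative_add) (auto simp: frechet_derivative_works)
  then show ?case using Suc by auto
qed (auto intro: continuous_on_add)

lemma C_k_scaleR: "C_k k f \<Longrightarrow> C_k k g \<Longrightarrow> C_k k (\<lambda>x. f x *\<^sub>R g x)"
proof (induction k arbitrary: f g)
  case (Suc k)
  have "frechet_derivative (\<lambda>x. f x *\<^sub>R g x) (at x)
      = (\<lambda>v. f x *\<^sub>R frechet_derivative g (at x) v + frechet_derivative f (at x) v *\<^sub>R g x)" for x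
    using Suc.prems
    by (intro frechet_derivative_at[symmetric] has_derivative_scaleR) (auto simp: frechet_derivative_works)
  then show ?case
    using Suc C_k_SucD[OF Suc.prems(1)] C_k_SucD[OF Suc.prems(2)] by (auto intro!: C_k_add)
qed (auto intro: continuous_on_scaleR)

lemma C_k_prod:
  fixes f :: "'i \<Rightarrow> 'a::real_normed_vector \<Rightarrow> real"
  assumes "\<And>i. i \<in> I \<Longrightarrow> C_k k (f i)"
  shows "C_k k (\<lambda>x. \<Prod>i\<in>I. f i x)"
  using assms
proof (induction I rule: infinite_finite_induct)
  case (insert i I)
  then show ?case using C_k_scaleR[of k "f i" "\<lambda>x. \<Prod>i\<in>I. f i x"] by simp
qed (auto simp: C_k_const)

text \<open>The span of the functions \<open>flat j\<close> is closed under differentiation.\<close>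

definition flat :: "nat \<Rightarrow> real \<Rightarrow> real" where
  "flat j t = (if 0 < t then (1 / t) ^ j * exp (- 1 / t) else 0)"

text \<open>The substitution s = 1/t turns the limit from the right into that of s^j / exp s at
  infinity; from the left the function is 0.\<close>

lemma flat_tendsto_zero: "((flat j) \<longlongrightarrow> 0) (at 0)"
proof -
  have "((\<lambda>s::real. s ^ j / exp s) \<longlongrightarrow> 0) at_top"
    by (rule tendsto_power_div_exp_0)
  then have "((\<lambda>t::real. (inverse t) ^ j / exp (inverse t)) \<longlongrightarrow> 0) (at_right 0)"
    by (rule filterlim_compose[OF _ filterlim_inverse_at_top_right])
  then have "(flat j \<longlongrightarrow> 0) (at_right 0)"
    by (rule Lim_transform_eventually)
      (auto simp: eventually_at_right_field flat_def exp_minus field_simps intro!: exI[of _ 1])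
  moreover have "(flat j \<longlongrightarrow> 0) (at_left 0)"
    by (rule Lim_transform_eventually[OF tendsto_const])
      (auto simp: eventually_at_left_field flat_def intro!: exI[of _ "-1"])
  ultimately show ?thesis by (simp add: filterlim_split_at)
qed

lemma DERIV_flat: "(flat j has_real_derivative (flat (j + 2) t - real j * flat (j + 1) t)) (at t)"
proof -
  consider "0 < t" | "t < 0" | "t = 0" by linarith
  then show ?thesis
  proof cases
    case 1
    have "((\<lambda>t. (1 / t) ^ j * exp (- 1 / t)) has_real_derivative
        (flat (j + 2) t - real j * flat (j + 1) t)) (at t)"
    \<comment> \<open>\<open>DERIV_power_Suc\<close> is stated for successor exponents; for exponent
      0 only the exponential is differentiated.\<close>
    proof (cases j)
      case 0
      then show ?thesis using 1
        by (auto intro!: derivative_eq_intros simp: flat_def field_simps power2_eq_square)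
    next
      case (Suc i)
      have "((\<lambda>t. (1 / t) ^ Suc i) has_real_derivative (1 + real i) * (- (1 / t\<^sup>2) * (1 / t) ^ i)) (at t)"
        by (rule DERIV_power_Suc) (use 1 in \<open>auto intro!: derivative_eq_intros simp: power2_eq_square\<close>)
      moreover have "((\<lambda>t. exp (- 1 / t)) has_real_derivative exp (- 1 / t) * (1 / t\<^sup>2)) (at t)"
        using 1 by (auto intro!: derivative_eq_intros simp: power2_eq_square)
      ultimately show ?thesis using 1
        unfolding Suc
        by (intro DERIV_cong[OF DERIV_mult]) (auto simp: flat_def field_simps power2_eq_square)
    qed
    then show ?thesis
      by (rule has_field_derivative_transform_within_open[of _ _ _ "{0<..}"])
        (use 1 in \<open>auto simp: flat_def\<close>)
  next
    case 2
    have "((\<lambda>t. 0) has_real_derivative 0) (at t)" by simp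
    then have "(flat j has_real_derivative 0) (at t)"
      by (rule has_field_derivative_transform_within_open[of _ _ _ "{..<0}"])
        (use 2 in \<open>auto simp: flat_def\<close>)
    then show ?thesis using 2 by (simp add: flat_def)
  next
    case 3
    \<comment> \<open>At 0 the difference quotient only adds one factor 1/h, so it is again a flat
      function and tends to 0.\<close>
    have "(\<lambda>h. (flat j (0 + h) - flat j 0) / h) = flat (j + 1)"
      by (auto simp: fun_eq_iff flat_def)
    then show ?thesis
      using 3 flat_tendsto_zero[of "j + 1"] by (simp add: DERIV_def flat_def)
  qed
qed

text \<open>Every directional derivative is a constant times a combination of flat functions of
  higher index with the same affine argument, hence the induction generalises over \<open>j\<close>.
  Affine arguments suffice for the distances to the faces of a box.\<close>

lemma C_k_flat_affine:
  fixes v :: "'a::real_inner"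
  shows "C_k k (\<lambda>x. flat j (v \<bullet> x + c))"
proof (induction k arbitrary: j)
  case 0
  have "continuous_on UNIV (flat j)"
    by (intro DERIV_continuous_on[OF has_field_derivative_at_within[OF DERIV_flat]])
  then show ?case
    unfolding C_k.simps
    by (rule continuous_on_compose2) (auto intro!: continuous_intros)
next
  case (Suc k)
  have D: "((\<lambda>x. flat j (v \<bullet> x + c)) has_derivative
      (\<lambda>h. (flat (j + 2) (v \<bullet> x + c) - real j * flat (j + 1) (v \<bullet> x + c)) * (v \<bullet> h))) (at x)" for x
    by (rule has_derivative_eq_rhs[OF DERIV_compose_FDERIV[OF DERIV_flat]])
      (auto intro!: derivative_eq_intros)
  have "C_k k (\<lambda>x. (v \<bullet> h) *\<^sub>R (flat (j + 2) (v \<bullet> x + c) + (- real j) *\<^sub>R flat (j + 1) (v \<bullet> x + c)))" for h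
    by (intro C_k_scaleR C_k_add C_k_const Suc)
  then show ?case
    unfolding C_k.simps frechet_derivative_at[OF D, symmetric]
    using D by (auto simp: differentiable_def algebra_simps)
qed

lemma flat_0_bounds: "0 \<le> flat 0 t" "flat 0 t \<le> 1"
  by (auto simp: flat_def)

text \<open>For positive \<open>t\<close> the exponent -1/((n+1)t) tends to 0. The factor
  \<open>Suc n\<close> is positive already at n = 0, so the sign of \<open>t\<close> decides every
  term.\<close>

lemma flat_0_scaled_tendsto: "(\<lambda>n. flat 0 (real (Suc n) * t)) \<longlonglongrightarrow> (if 0 < t then 1 else 0)"
proof (cases "0 < t")
  case True
  have "(\<lambda>n. exp (- (1 / t) * inverse (real (Suc n)))) \<longlonglongrightarrow> exp (- (1 / t) * 0)"
    by (intro tendsto_intros LIMSEQ_inverse_real_of_nat)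
  moreover have "flat 0 (real (Suc n) * t) = exp (- (1 / t) * inverse (real (Suc n)))" for n
  proof -
    have "0 < real (Suc n) * t" using True by simp
    then show ?thesis by (simp add: flat_def divide_simps del: of_nat_Suc)
  qed
  ultimately show ?thesis using True by simp
next
  case False
  then have "flat 0 (real (Suc n) * t) = 0" for n
    by (auto simp: flat_def zero_less_mult_iff)
  then show ?thesis using False by simp
qed

section \<open>Smooth bumps on boxes\<close>

text \<open>A product of smooth cutoffs, one for each face of the box; as \<open>n\<close> grows
  they steepen and the product approximates the indicator of the open box from below.\<close>

definition box_bump :: "'a::euclidean_space \<Rightarrow> 'a \<Rightarrow> nat \<Rightarrow> 'a \<Rightarrow> real" where
  "box_bump a b n x =
     (\<Prod>i\<in>Basis. flat 0 (real (Suc n) * ((x - a) \<bullet> i)) * flat 0 (real (Suc n) * ((b - x) \<bullet> i)))"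

lemma C_k_box_bump: "C_k k (box_bump a b n)"
proof -
  \<comment> \<open>Both factors are first brought to the form \<open>v \<bullet> x + c\<close>
    required by \<open>C_k_flat_affine\<close>.\<close>
  have "C_k k (\<lambda>x. flat 0 ((real (Suc n) *\<^sub>R i) \<bullet> x + - real (Suc n) * (a \<bullet> i))
      *\<^sub>R flat 0 ((- real (Suc n) *\<^sub>R i) \<bullet> x + real (Suc n) * (b \<bullet> i)))" for i
    by (intro C_k_scaleR C_k_flat_affine)
  moreover have "(real (Suc n) *\<^sub>R i) \<bullet> x + - real (Suc n) * (a \<bullet> i) = real (Suc n) * ((x - a) \<bullet> i)"
    "(- real (Suc n) *\<^sub>R i) \<bullet> x + real (Suc n) * (b \<bullet> i) = real (Suc n) * ((b - x) \<bullet> i)" for i x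
    by (simp_all add: algebra_simps inner_simps inner_commute)
  ultimately have "C_k k (\<lambda>x. flat 0 (real (Suc n) * ((x - a) \<bullet> i)) * flat 0 (real (Suc n) * ((b - x) \<bullet> i)))" for i
    by (simp only: real_scaleR_def)
  then show ?thesis
    unfolding box_bump_def[abs_def] by (intro C_k_prod)
qed

lemma box_bump_bounds: "0 \<le> box_bump a b n x" "box_bump a b n x \<le> indicator (box a b) x"
proof -
  show "0 \<le> box_bump a b n x"
    unfolding box_bump_def by (intro prod_nonneg) (simp add: flat_0_bounds)
  show "box_bump a b n x \<le> indicator (box a b) x"
  proof (cases "x \<in> box a b")
    case True
    have "box_bump a b n x \<le> (\<Prod>i\<in>(Basis::'a set). 1)"
      unfolding box_bump_def by (intro prod_mono) (auto simp: flat_0_bounds mult_le_one)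
    then show ?thesis using True by simp
  next
    case False
    then obtain i where i: "i \<in> Basis" "(x - a) \<bullet> i \<le> 0 \<or> (b - x) \<bullet> i \<le> 0"
      by (auto simp: mem_box inner_diff_left not_less)
    then have "flat 0 (real (Suc n) * ((x - a) \<bullet> i)) * flat 0 (real (Suc n) * ((b - x) \<bullet> i)) = 0"
      by (auto simp: flat_def zero_less_mult_iff)
    then have "box_bump a b n x = 0"
      unfolding box_bump_def using i(1) by (intro prod_zero) auto
    then show ?thesis by simp
  qed
qed

lemma box_bump_tendsto: "(\<lambda>n. box_bump a b n x) \<longlonglongrightarrow> indicator (box a b) x"
proof -
  have "(\<lambda>n. box_bump a b n x) \<longlonglongrightarrow>
      (\<Prod>i\<in>Basis. (if 0 < (x - a) \<bullet> i then 1 else 0) * (if 0 < (b - x) \<bullet> i then 1 else 0))"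
    unfolding box_bump_def by (intro tendsto_prod tendsto_mult flat_0_scaled_tendsto)
  also have "(\<Prod>i\<in>Basis. (if 0 < (x - a) \<bullet> i then 1 else 0) * (if 0 < (b - x) \<bullet> i then 1 else 0))
      = (indicator (box a b) x :: real)"
  proof (cases "x \<in> box a b")
    case True
    then show ?thesis by (auto simp: mem_box inner_diff_left intro!: prod.neutral)
  next
    case False
    then obtain i where "i \<in> Basis" "(x - a) \<bullet> i \<le> 0 \<or> (b - x) \<bullet> i \<le> 0"
      by (auto simp: mem_box inner_diff_left not_less)
    then show ?thesis
      using False by (auto intro!: prod_zero bexI[of _ i])
  qed
  finally show ?thesis .
qed

text \<open>A test function has the closure of its support inside \<open>\<Omega>\<close>; the bump
  vanishes off the open box, so it is the closed box that has to fit.\<close>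

lemma box_bump_test_function:
  assumes "cbox a b \<subseteq> \<Omega>"
  shows "(\<lambda>x. box_bump a b n x *\<^sub>R e) \<in> test_functions \<Omega>"
proof -
  have "box_bump a b n x = 0" if "x \<notin> box a b" for x
    using box_bump_bounds[of a b n x] that by simp
  then have "{x. box_bump a b n x *\<^sub>R e \<noteq> 0} \<subseteq> box a b"
    by auto
  then have "closure {x. box_bump a b n x *\<^sub>R e \<noteq> 0} \<subseteq> cbox a b"
    using box_subset_cbox[of a b] by (intro closure_minimal) auto
  moreover from this have "compact (closure {x. box_bump a b n x *\<^sub>R e \<noteq> 0})"
    by (meson bounded_cbox bounded_subset closed_closure compact_eq_bounded_closed)
  ultimately show ?thesis
    using assms by (auto simp: test_functions_def intro!: C_k_scaleR C_k_box_bump C_k_const)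
qed

section \<open>Integrable functions determined by their integrals over boxes\<close>

text \<open>Open boxes are an intersection-stable generator of the Borel sets, so a Dynkin argument
  spreads the vanishing of the integral to all Borel sets, and completion to all Lebesgue sets; then
  \<open>h\<close> is a density of the zero measure.\<close>

lemma AE_zero_if_box_integrals_zero:
  fixes h :: "'a::euclidean_space \<Rightarrow> real"
  assumes h: "integrable lebesgue h"
    and box: "\<And>a b. (LINT x:box a b|lebesgue. h x) = 0"
  shows "AE x in lebesgue. h x = 0"
proof (rule sigma_finite_measure.density_zero[OF _ h])
  show "sigma_finite_measure (lebesgue :: 'a measure)"
  proof
    obtain A :: "'a set set" where "countable A" "A \<subseteq> sets lborel" "\<Union>A = space lborel"
        "\<forall>a\<in>A. emeasure lborel a \<noteq> \<infinity>"
      using lborel.sigma_finite_countable by blast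
    then show "\<exists>A::'a set set. countable A \<and> A \<subseteq> sets lebesgue \<and> \<Union>A = space lebesgue \<and>
        (\<forall>a\<in>A. emeasure lebesgue a \<noteq> \<infinity>)"
      by (intro exI[of _ A]) auto
  qed
  have int: "set_integrable lebesgue A h" if "A \<in> sets lebesgue" for A
    using that h unfolding set_integrable_def by (rule integrable_mult_indicator)
  \<comment> \<open>The complement step of the Dynkin induction needs the integral over the whole
    space, which is exhausted by centred boxes.\<close>
  have UNIV: "(LINT x:UNIV|lebesgue. h x) = 0"
  proof -
    let ?A = "\<lambda>n::nat. box (- (real n *\<^sub>R One)) (real n *\<^sub>R One) :: 'a set"
    have U: "(\<Union>i. ?A i) = UNIV" using UN_box_eq_UNIV by auto
    have "incseq ?A"
    proof (rule incseq_SucI)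
      show "?A n \<subseteq> ?A (Suc n)" for n
        by (fastforce simp: mem_box inner_sum_Basis algebra_simps)
    qed
    then have "(\<lambda>n. LINT x:?A n|lebesgue. h x) \<longlonglongrightarrow> (LINT x:(\<Union>i. ?A i)|lebesgue. h x)"
      by (intro set_integral_cont_up int) auto
    then show ?thesis
      unfolding U box by (simp add: LIMSEQ_const_iff)
  qed
  have borel: "(LINT x:A|lebesgue. h x) = 0" if "A \<in> sets borel" for A
  proof -
    have A: "A \<in> sigma_sets UNIV (range (\<lambda>(a, b). box a b :: 'a set))"
      using that by (simp add: borel_eq_box)
    have sub: "sigma_sets UNIV (range (\<lambda>(a, b). box a b :: 'a set)) \<subseteq> sets lebesgue"
      by (subst borel_eq_box[symmetric, THEN arg_cong[where f=sets], simplified]) auto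
    show ?thesis
    proof (rule sigma_sets_induct_disjoint[OF _ _ A])
      show "Int_stable (range (\<lambda>(a, b). box a b :: 'a set))"
        by (auto simp: Int_stable_def box_Int_box)
      show "(LINT x:B|lebesgue. h x) = 0" if "B \<in> range (\<lambda>(a, b). box a b)" for B
        using that box by auto
      show "(LINT x:UNIV - B|lebesgue. h x) = 0"
        if "B \<in> sigma_sets UNIV (range (\<lambda>(a, b). box a b :: 'a set))" "(LINT x:B|lebesgue. h x) = 0" for B
      proof -
        have "B \<in> sets lebesgue" using that sub by auto
        then have "(LINT x:B \<union> (UNIV - B)|lebesgue. h x)
            = (LINT x:B|lebesgue. h x) + (LINT x:UNIV - B|lebesgue. h x)"
          by (intro set_integral_Un int) auto
        then show ?thesis using that UNIV by simp
      qed
      show "(LINT x:(\<Union>i. B i)|lebesgue. h x) = 0"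
        if "disjoint_family B" "range B \<subseteq> sigma_sets UNIV (range (\<lambda>(a, b). box a b :: 'a set))"
          "\<And>i. (LINT x:B i|lebesgue. h x) = 0" for B :: "nat \<Rightarrow> 'a set"
      proof -
        have B: "B i \<in> sets lebesgue" for i using that(2) sub by auto
        have "(LINT x:(\<Union>i. B i)|lebesgue. h x) = (\<Sum>i. LINT x:B i|lebesgue. h x)"
          using that(1) by (intro lebesgue_integral_countable_add B int sets.countable_UN)
            (auto simp: disjoint_family_on_def B)
        then show ?thesis using that(3) by simp
      qed
    qed (auto simp: set_lebesgue_integral_def)
  qed
  \<comment> \<open>A Lebesgue set differs from the Borel set \<open>S\<close> only inside the null
    set \<open>N'\<close>.\<close>
  fix A :: "'a set" assume "A \<in> sets lebesgue"
  then obtain S N N' where A: "A = S \<union> N" "N \<subseteq> N'" "N' \<in> null_sets lborel" "S \<in> sets lborel"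
    by (rule sets_completionE)
  then have "AE x in lebesgue. x \<notin> N'"
    by (intro AE_not_in null_sets_completionI)
  then have "AE x in lebesgue. indicator A x *\<^sub>R h x = indicator S x *\<^sub>R h x"
    by eventually_elim (use A in \<open>auto simp: indicator_def\<close>)
  moreover have "S \<in> sets lebesgue" using A(4) by auto
  ultimately have "(LINT x:A|lebesgue. h x) = (LINT x:S|lebesgue. h x)"
    unfolding set_lebesgue_integral_def
    using int \<open>A \<in> sets lebesgue\<close> unfolding set_integrable_def
    by (intro integral_cong_AE) (auto dest: borel_measurable_integrable)
  then show "(LINT x:A|lebesgue. h x) = 0" using borel A(4) by simp
qed

section \<open>Hilbert spaces as closed subspaces\<close>

text \<open>The representing vector is the limit of a minimising sequence of a quadratic functional
  on \<open>S\<close>. The first variation is taken along the sequence and then passed to the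
  limit.\<close>

lemma riesz_closed_subspace:
  fixes S :: "'h::{real_inner,complete_space} set" and e :: "'h \<Rightarrow> real"
  assumes S: "closed S" "subspace S"
    and add: "\<And>x y. x \<in> S \<Longrightarrow> y \<in> S \<Longrightarrow> e (x + y) = e x + e y"
    and scale: "\<And>x c. x \<in> S \<Longrightarrow> e (c *\<^sub>R x) = c * e x"
    and bounded: "\<And>x. x \<in> S \<Longrightarrow> \<bar>e x\<bar> \<le> C * norm x"
  shows "\<exists>y\<in>S. \<forall>x\<in>S. e x = x \<bullet> y"
proof -
  \<comment> \<open>If \<open>y\<close> represents \<open>e\<close>, this equals |x - y|^2 - |y|^2,
    so its minimiser is \<open>y\<close>.\<close>
  define Q where "Q x = x \<bullet> x - 2 * e x" for x
  have "- (C\<^sup>2) \<le> Q x" if "x \<in> S" for x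
  proof -
    \<comment> \<open>Completing the square bounds \<open>Q\<close> below by minus the square of
      \<open>C\<close>.\<close>
    have "0 \<le> (norm x - C)\<^sup>2" by simp
    then have "- (C\<^sup>2) \<le> (norm x)\<^sup>2 - 2 * (C * norm x)"
      by (simp add: power2_eq_square algebra_simps)
    also have "\<dots> \<le> Q x"
      using bounded[OF that] by (simp add: Q_def power2_norm_eq_inner)
    finally show ?thesis .
  qed
  then have bdd: "bdd_below (Q ` S)" by (rule bdd_belowI2)
  define m where "m = Inf (Q ` S)"
  have m: "m \<le> Q x" if "x \<in> S" for x
    unfolding m_def using bdd that by (auto intro: cInf_lower)
  have "S \<noteq> {}" using S(2) subspace_0 by blast
  then have "\<exists>x\<in>S. Q x < m + inverse (real (Suc n))" for n
    using cInf_lessD[of "Q ` S" "m + inverse (real (Suc n))"] by (auto simp: m_def)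
  then obtain s where sS: "\<And>n. s n \<in> S" and s: "\<And>n. Q (s n) < m + inverse (real (Suc n))"
    by metis
  \<comment> \<open>The parallelogram law at the midpoint \<open>z\<close>: near-minimisers of
    \<open>Q\<close> are close to each other.\<close>
  have par: "(norm (x - y))\<^sup>2 \<le> 2 * Q x + 2 * Q y - 4 * m" if "x \<in> S" "y \<in> S" for x y
  proof -
    define z where "z = (1/2) *\<^sub>R (x + y)"
    have xy: "z \<in> S"
      using S(2) that by (simp add: z_def subspace_scale subspace_add)
    have "e (z) = (e x + e y) / 2"
      using that S(2) scale[of "x + y" "1/2"] by (simp add: z_def add subspace_add)
    then have "2 * Q (z) = Q x + Q y - (norm (x - y))\<^sup>2 / 2"
      unfolding Q_def power2_norm_eq_inner
      by (simp only: z_def[THEN arg_cong, of "\<lambda>z. z \<bullet> z"] inner_add_left inner_add_right inner_diff_left inner_diff_right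
          inner_scaleR_left inner_scaleR_right inner_commute[of y x]) (simp add: field_simps)
    then show ?thesis using m[OF xy] by (simp add: field_simps)
  qed
  have "Cauchy s"
  proof (rule metric_CauchyI)
    fix \<epsilon> :: real assume "0 < \<epsilon>"
    then obtain k where k: "inverse (real (Suc k)) < \<epsilon>\<^sup>2 / 4"
      using reals_Archimedean[of "\<epsilon>\<^sup>2 / 4"] by auto
    have "dist (s i) (s j) < \<epsilon>" if "k \<le> i" "k \<le> j" for i j
    proof -
      have "inverse (real (Suc i)) \<le> inverse (real (Suc k))" "inverse (real (Suc j)) \<le> inverse (real (Suc k))"
        using that by (auto intro!: le_imp_inverse_le)
      then have "(norm (s i - s j))\<^sup>2 < \<epsilon>\<^sup>2"
        using par[OF sS sS, of i j] s[of i] s[of j] k by linarith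
      then show ?thesis
        unfolding dist_norm by (rule power2_less_imp_less) (use \<open>0 < \<epsilon>\<close> in simp)
    qed
    then show "\<exists>k. \<forall>i\<ge>k. \<forall>j\<ge>k. dist (s i) (s j) < \<epsilon>" by blast
  qed
  then obtain y where y: "s \<longlonglongrightarrow> y"
    using Cauchy_convergent convergent_def by blast
  have yS: "y \<in> S"
    using S(1) sS y closed_sequentially by blast
  have "e x = x \<bullet> y" if x: "x \<in> S" for x
  proof (cases "x = 0")
    case False
    have ineq: "0 \<le> t\<^sup>2 * (x \<bullet> x) + 2 * t * (x \<bullet> y - e x)" for t
    proof (rule LIMSEQ_le_const)
      show "(\<lambda>n. t\<^sup>2 * (x \<bullet> x) + 2 * t * (x \<bullet> s n - e x) + inverse (real (Suc n)))
          \<longlonglongrightarrow> t\<^sup>2 * (x \<bullet> x) + 2 * t * (x \<bullet> y - e x)"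
        using tendsto_add[OF _ LIMSEQ_inverse_real_of_nat,
            of "\<lambda>n. t\<^sup>2 * (x \<bullet> x) + 2 * t * (x \<bullet> s n - e x)" "t\<^sup>2 * (x \<bullet> x) + 2 * t * (x \<bullet> y - e x)"]
        by (simp add: tendsto_intros y)
      have "0 \<le> t\<^sup>2 * (x \<bullet> x) + 2 * t * (x \<bullet> s n - e x) + inverse (real (Suc n))" for n
      proof -
        have tx: "t *\<^sub>R x \<in> S" using S(2) x by (rule subspace_scale)
        then have "s n + t *\<^sub>R x \<in> S" using S(2) sS by (intro subspace_add)
        then have "m \<le> Q (s n + t *\<^sub>R x)" by (rule m)
        also have "Q (s n + t *\<^sub>R x) = Q (s n) + (t\<^sup>2 * (x \<bullet> x) + 2 * t * (x \<bullet> s n - e x))"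
          using x tx sS[of n]
          by (simp add: Q_def add scale inner_simps inner_commute power2_eq_square algebra_simps)
        finally show ?thesis using s[of n] by linarith
      qed
      then show "\<exists>k. \<forall>n\<ge>k. 0 \<le> t\<^sup>2 * (x \<bullet> x) + 2 * t * (x \<bullet> s n - e x) + inverse (real (Suc n))"
        by blast
    qed
    define d where "d = x \<bullet> y - e x"
    \<comment> \<open>This value of \<open>t\<close> minimises the quadratic in \<open>ineq\<close>;
      its minimum is negative unless \<open>d\<close> vanishes.\<close>
    have "0 \<le> (- d / (x \<bullet> x))\<^sup>2 * (x \<bullet> x) + 2 * (- d / (x \<bullet> x)) * d"
      using ineq[of "- d / (x \<bullet> x)"] by (simp add: d_def)
    also have "\<dots> = - (d\<^sup>2 / (x \<bullet> x))"
      using False by (simp add: power2_eq_square field_simps)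
    finally have "d\<^sup>2 / (x \<bullet> x) \<le> 0" by simp
    moreover have "0 < x \<bullet> x" using False by simp
    ultimately have "d = 0" by (simp add: divide_le_0_iff)
    then show ?thesis by (simp add: d_def)
  qed (use scale[of 0 0] subspace_0[OF S(2)] in simp)
  then show ?thesis using yS by blast
qed

text \<open>A space given by a set and a norm function borrows completeness and its inner product
  from a Hilbert type through \<open>T\<close>. The same interface is reused for the dual and for
  the product space.\<close>

locale hilbert_isometry =
  fixes V :: "'a::real_vector set" and N :: "'a \<Rightarrow> real"
    and T :: "'a \<Rightarrow> 'h::{real_inner,complete_space}"
  assumes subspace: "subspace V"
    and T_add: "x \<in> V \<Longrightarrow> y \<in> V \<Longrightarrow> T (x + y) = T x + T y"
    and T_scaleR: "x \<in> V \<Longrightarrow> T (c *\<^sub>R x) = c *\<^sub>R T x"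
    and N_eq: "x \<in> V \<Longrightarrow> N x = norm (T x)"
    and T_eq_0: "x \<in> V \<Longrightarrow> T x = 0 \<Longrightarrow> x = 0"
    and closed_range: "closed (T ` V)"
begin

lemmas V_zero = subspace_0[OF subspace]
  and V_add = subspace_add[OF subspace]
  and V_diff = subspace_diff[OF subspace]
  and V_scaleR = subspace_scale[OF subspace]

lemma T_zero: "T 0 = 0"
  using T_scaleR[OF V_zero, of 0] by simp

lemma T_diff: "x \<in> V \<Longrightarrow> y \<in> V \<Longrightarrow> T (x - y) = T x - T y"
  using T_add[of "x - y" y] V_diff[of x y] by simp

lemma inj_on_T: "inj_on T V"
proof (rule inj_onI)
  fix x y assume "x \<in> V" "y \<in> V" "T x = T y"
  then show "x = y" using T_eq_0[of "x - y"] by (simp add: T_diff V_diff)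
qed

lemma subspace_range: "subspace (T ` V)"
proof (rule subspaceI)
  show "0 \<in> T ` V" by (metis T_zero V_zero imageI)
  show "g + h \<in> T ` V" if "g \<in> T ` V" "h \<in> T ` V" for g h
    using that by (metis (no_types) T_add V_add imageE imageI)
  show "c *\<^sub>R h \<in> T ` V" if "h \<in> T ` V" for c h
    using that by (metis (no_types) T_scaleR V_scaleR imageE imageI)
qed

lemma normed: "normed_on V N"
  unfolding normed_on_def
proof (intro conjI ballI allI subspace)
  show "0 \<le> N x" "N x = 0 \<longleftrightarrow> x = 0" "N (c *\<^sub>R x) = \<bar>c\<bar> * N x" if "x \<in> V" for x c
    using that by (auto simp: N_eq V_scaleR T_scaleR T_zero dest: T_eq_0)
  show "N (x + y) \<le> N x + N y" if "x \<in> V" "y \<in> V" for x y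
    using that by (simp add: N_eq V_add T_add norm_triangle_ineq)
qed

lemma banach: "banach_on V N"
  unfolding banach_on_def
proof (intro conjI normed allI impI)
  fix s :: "nat \<Rightarrow> 'a"
  assume s: "range s \<subseteq> V \<and> (\<forall>\<epsilon>>0. \<exists>k. \<forall>m\<ge>k. \<forall>n\<ge>k. N (s m - s n) < \<epsilon>)"
  then have sV: "s n \<in> V" for n by auto
  then have Ns: "N (s m - s n) = norm (T (s m) - T (s n))" for m n
    by (simp add: N_eq V_diff T_diff)
  have "Cauchy (\<lambda>n. T (s n))"
    using s by (auto simp: Cauchy_iff Ns)
  then obtain h where h: "(\<lambda>n. T (s n)) \<longlonglongrightarrow> h"
    using Cauchy_convergent convergent_def by blast
  then have "h \<in> T ` V"
    using closed_range sV by (meson closed_sequentially imageI)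
  then obtain x where x: "x \<in> V" "h = T x" by blast
  have "(\<lambda>n. norm (T (s n) - T x)) \<longlonglongrightarrow> 0"
    using h x(2) by (simp add: LIM_zero tendsto_norm_zero)
  then have "(\<lambda>n. N (s n - x)) \<longlonglongrightarrow> 0"
    using x(1) sV by (simp add: N_eq V_diff T_diff)
  with x(1) show "\<exists>x\<in>V. (\<lambda>n. N (s n - x)) \<longlonglongrightarrow> 0" by blast
qed

section \<open>Riesz representation of the dual and of the product\<close>

text \<open>The Riesz map for the inner product pulled back along \<open>T\<close>; the value 0 off
  \<open>V\<close> is what \<open>dual\<close> demands.\<close>

definition rep :: "'a \<Rightarrow> 'a \<Rightarrow> real" where
  "rep y = (\<lambda>x. if x \<in> V then T x \<bullet> T y else 0)"

lemma rep_in_dual: "y \<in> V \<Longrightarrow> rep y \<in> dual V N"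
  unfolding dual_def rep_def
  by (auto simp: V_add V_scaleR T_add T_scaleR N_eq inner_add_left mult.commute
      intro!: exI[of _ "norm (T y)"] order_trans[OF Cauchy_Schwarz_ineq2])

lemma rep_surj:
  assumes e: "e \<in> dual V N"
  shows "\<exists>y\<in>V. e = rep y"
proof -
  have e: "\<And>x. x \<notin> V \<Longrightarrow> e x = 0"
    "\<And>x y. x \<in> V \<Longrightarrow> y \<in> V \<Longrightarrow> e (x + y) = e x + e y"
    "\<And>x c. x \<in> V \<Longrightarrow> e (c *\<^sub>R x) = c * e x"
    using e by (auto simp: dual_def)
  obtain C where C: "\<And>x. x \<in> V \<Longrightarrow> \<bar>e x\<bar> \<le> C * N x"
    using assms unfolding dual_def by blast
  define g where "g = the_inv_into V T"
  have g: "g (T x) = x" if "x \<in> V" for x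
    unfolding g_def using inj_on_T that by (rule the_inv_into_f_f)
  have "\<exists>h\<in>T ` V. \<forall>z\<in>T ` V. e (g z) = z \<bullet> h"
  proof (rule riesz_closed_subspace[OF closed_range subspace_range])
    show "e (g (z + z')) = e (g z) + e (g z')" if "z \<in> T ` V" "z' \<in> T ` V" for z z'
      using that by (auto simp: g e V_add simp flip: T_add)
    show "e (g (c *\<^sub>R z)) = c * e (g z)" if "z \<in> T ` V" for z c
      using that by (auto simp: g e V_scaleR simp flip: T_scaleR)
    show "\<bar>e (g z)\<bar> \<le> C * norm z" if "z \<in> T ` V" for z
      using that C by (auto simp: g N_eq)
  qed
  then obtain y where "y \<in> V" "\<And>x. x \<in> V \<Longrightarrow> e x = T x \<bullet> T y"
    using g by fastforce
  then show ?thesis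
    using e(1) by (intro bexI[of _ y]) (auto simp: rep_def)
qed

lemma dual_eq: "dual V N = rep ` V"
  using rep_surj rep_in_dual by blast

lemma inj_on_rep: "inj_on rep V"
proof (rule inj_onI)
  fix x y assume xy: "x \<in> V" "y \<in> V" "rep x = rep y"
  then have "rep x (x - y) = rep y (x - y)" by simp
  then have "T (x - y) \<bullet> T (x - y) = 0"
    using xy V_diff[of x y] by (simp add: rep_def T_diff inner_diff_right)
  then show "x = y"
    using T_eq_0[of "x - y"] V_diff xy by simp
qed

lemma rep_add: "x \<in> V \<Longrightarrow> y \<in> V \<Longrightarrow> rep (x + y) = rep x + rep y"
  by (auto simp: rep_def T_add inner_add_right fun_eq_iff)

lemma rep_scaleR: "x \<in> V \<Longrightarrow> rep (c *\<^sub>R x) = c *\<^sub>R rep x"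
  by (auto simp: rep_def T_scaleR fun_eq_iff scaleR_fun_def)

lemma dual_norm_rep:
  assumes y: "y \<in> V"
  shows "dual_norm V N (rep y) = norm (T y)"
proof -
  have le: "\<bar>rep y x\<bar> \<le> norm (T y)" if "x \<in> V" "N x \<le> 1" for x
  proof -
    have "\<bar>rep y x\<bar> \<le> norm (T x) * norm (T y)"
      using that by (simp add: rep_def Cauchy_Schwarz_ineq2)
    also have "\<dots> \<le> 1 * norm (T y)"
      using that by (intro mult_right_mono) (auto simp: N_eq)
    finally show ?thesis by simp
  qed
  \<comment> \<open>The normalised \<open>y\<close> attains the supremum. If \<open>T y\<close> is
    0, then \<open>inverse 0 = 0\<close> makes \<open>x\<close> zero and the claims still
    hold.\<close>
  define x where "x = inverse (norm (T y)) *\<^sub>R y"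
  have x: "x \<in> V" "N x \<le> 1" "\<bar>rep y x\<bar> = norm (T y)"
    using y by (simp_all add: x_def V_scaleR N_eq rep_def T_scaleR divide_simps
        power2_norm_eq_inner[symmetric] power2_eq_square)
  show ?thesis
    unfolding dual_norm_def
  proof (rule antisym)
    show "(SUP x\<in>{x \<in> V. N x \<le> 1}. \<bar>rep y x\<bar>) \<le> norm (T y)"
      using x(1,2) le by (intro cSUP_least) auto
    show "norm (T y) \<le> (SUP x\<in>{x \<in> V. N x \<le> 1}. \<bar>rep y x\<bar>)"
      using x le by (intro cSUP_upper2[of _ _ x]) (auto intro!: bdd_aboveI2)
  qed
qed

definition unrep :: "('a \<Rightarrow> real) \<Rightarrow> 'a" where
  "unrep = the_inv_into V rep"

lemma unrep_rep [simp]: "y \<in> V \<Longrightarrow> unrep (rep y) = y"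
  unfolding unrep_def using inj_on_rep by (rule the_inv_into_f_f)

lemma unrep_in: "e \<in> dual V N \<Longrightarrow> unrep e \<in> V"
  by (auto simp: dual_eq)

lemma rep_unrep: "e \<in> dual V N \<Longrightarrow> rep (unrep e) = e"
  by (auto simp: dual_eq)

lemma inner_unrep_rep: "e \<in> dual V N \<Longrightarrow> y \<in> V \<Longrightarrow> T (unrep e) \<bullet> T y = e y"
  using fun_cong[OF rep_unrep, of e y] by (simp add: rep_def inner_commute)

text \<open>The inverse Riesz map preserves the norm by \<open>dual_norm_rep\<close>, and its
  composition with \<open>T\<close> has the same closed range as \<open>T\<close>.\<close>

lemma dual_hilbert_isometry: "hilbert_isometry (dual V N) (dual_norm V N) (\<lambda>e. T (unrep e))"
proof
  show "subspace (dual V N)"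
  proof (rule subspaceI)
    have "rep 0 = 0" using rep_scaleR[OF V_zero, of 0] by simp
    then show "0 \<in> dual V N" using V_zero by (force simp: dual_eq)
  qed (auto simp: dual_eq V_add V_scaleR simp flip: rep_add rep_scaleR)
  show "T (unrep (e + f)) = T (unrep e) + T (unrep f)" if "e \<in> dual V N" "f \<in> dual V N" for e f
    using that by (auto simp: dual_eq V_add T_add simp flip: rep_add)
  show "T (unrep (c *\<^sub>R e)) = c *\<^sub>R T (unrep e)" if "e \<in> dual V N" for e c
    using that by (auto simp: dual_eq V_scaleR T_scaleR simp flip: rep_scaleR)
  show "dual_norm V N e = norm (T (unrep e))" if "e \<in> dual V N" for e
    using that by (auto simp: dual_eq dual_norm_rep)
  show "e = 0" if "e \<in> dual V N" "T (unrep e) = 0" for e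
  proof -
    have "unrep e = 0" using that T_eq_0 unrep_in by blast
    then have "e = rep 0" using rep_unrep[OF that(1)] by simp
    also have "rep 0 = 0" using rep_scaleR[OF V_zero, of 0] by simp
    finally show ?thesis .
  qed
  have "(\<lambda>e. T (unrep e)) ` dual V N = T ` V"
    by (auto simp: dual_eq image_iff)
  then show "closed ((\<lambda>e. T (unrep e)) ` dual V N)"
    using closed_range by simp
qed

lemma product_hilbert_isometry:
  "hilbert_isometry (product_space V N :: ('a \<times> ('a \<Rightarrow> real) \<times> (real^'m) \<times> (real^'m)) set)
     (product_norm V N) (\<lambda>(a, b, c, d). (T a, T (unrep b), c, d))"
proof -
  interpret dual: hilbert_isometry "dual V N" "dual_norm V N" "\<lambda>e. T (unrep e)"
    by (rule dual_hilbert_isometry)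
  let ?P = "product_space V N :: ('a \<times> ('a \<Rightarrow> real) \<times> (real^'m) \<times> (real^'m)) set"
  let ?T = "\<lambda>(a, b, c, d). (T a, T (unrep b), c, d)"
  show ?thesis
  proof
    show "subspace ?P"
      unfolding product_space_def by (intro subspace_Times subspace dual.subspace subspace_UNIV)
    have "?T ` ?P = T ` V \<times> (\<lambda>e. T (unrep e)) ` dual V N \<times> UNIV \<times> UNIV"
    proof
      show "T ` V \<times> (\<lambda>e. T (unrep e)) ` dual V N \<times> UNIV \<times> UNIV \<subseteq> ?T ` ?P"
      proof clarify
        fix a b and c d :: "real^'m" assume "a \<in> V" "b \<in> dual V N"
        then show "(T a, T (unrep b), c, d) \<in> ?T ` ?P"
          by (intro image_eqI[of _ _ "(a, b, c, d)"]) (auto simp: product_space_def)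
      qed
    qed (auto simp: product_space_def)
    then show "closed (?T ` ?P)"
      by (simp add: closed_Times closed_range dual.closed_range)
    show "?T (x + y) = ?T x + ?T y" if "x \<in> ?P" "y \<in> ?P" for x y
      using that by (cases x; cases y) (simp add: product_space_def T_add dual.T_add)
    show "?T (r *\<^sub>R x) = r *\<^sub>R ?T x" if "x \<in> ?P" for x r
      using that by (cases x) (simp add: product_space_def T_scaleR dual.T_scaleR)
    show "product_norm V N x = norm (?T x)" if "x \<in> ?P" for x
      using that by (cases x) (simp add: product_space_def product_norm_def N_eq dual.N_eq norm_Pair add.assoc)
    show "x = 0" if "x \<in> ?P" "?T x = 0" for x
      using that by (cases x) (simp add: product_space_def zero_prod_def T_eq_0 dual.T_eq_0)
  qed
qed

end

section \<open>The Dirac structure on the product space\<close>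

context hilbert_isometry
begin

text \<open>Reflexivity: the Riesz representative of \<open>e\<close> in the product is
  \<open>(a, b, c, d)\<close>; pairing with \<open>a\<close> is the functional \<open>rep a\<close>,
  and pairing with \<open>b\<close> in the dual is evaluation at \<open>unrep b\<close>.\<close>

lemma dual_eq_to_dual:
  fixes e :: "'a \<times> ('a \<Rightarrow> real) \<times> (real^'m) \<times> (real^'m) \<Rightarrow> real"
  assumes e: "e \<in> dual (product_space V N) (product_norm V N)"
  shows "\<exists>J E i v. J \<in> dual V N \<and> E \<in> V \<and> e = to_dual V N (J, E, i, v)"
proof -
  interpret P: hilbert_isometry "product_space V N :: ('a \<times> ('a \<Rightarrow> real) \<times> (real^'m) \<times> (real^'m)) set"
    "product_norm V N" "\<lambda>(a, b, c, d). (T a, T (unrep b), c, d)"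
    by (rule product_hilbert_isometry)
  obtain a b c d where y: "(a, b, c, d) \<in> product_space V N" and e: "e = P.rep (a, b, c, d)"
    using P.rep_surj[OF e] by (metis prod_cases4)
  have ab: "a \<in> V" "b \<in> dual V N"
    using y by (auto simp: product_space_def)
  have "e = to_dual V N (rep a, unrep b, c, d)"
  proof
    fix x :: "'a \<times> ('a \<Rightarrow> real) \<times> (real^'m) \<times> (real^'m)"
    obtain a' b' c' d' where x: "x = (a', b', c', d')" by (cases x)
    have "T a' \<bullet> T a = rep a a'" "T (unrep b') \<bullet> T (unrep b) = b' (unrep b)"
      if "x \<in> product_space V N"
      using that ab by (auto simp: x product_space_def rep_def inner_unrep_rep unrep_in)
    then show "e x = to_dual V N (rep a, unrep b, c, d) x"
      unfolding e P.rep_def to_dual_def x by simp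
  qed
  then show ?thesis
    using ab rep_in_dual unrep_in by blast
qed

text \<open>Boundedness comes for free, because the functional has the Riesz representative
  \<open>(unrep J, rep E, i, v)\<close>.\<close>

lemma to_dual_in_dual:
  assumes "J \<in> dual V N" "E \<in> V"
  shows "to_dual V N (J, E, i, v :: real^'m) \<in> dual (product_space V N) (product_norm V N)"
proof -
  interpret P: hilbert_isometry "product_space V N :: ('a \<times> ('a \<Rightarrow> real) \<times> (real^'m) \<times> (real^'m)) set"
    "product_norm V N" "\<lambda>(a, b, c, d). (T a, T (unrep b), c, d)"
    by (rule product_hilbert_isometry)
  have in_P: "(unrep J, rep E, i, v) \<in> product_space V N"
    using assms by (simp add: product_space_def unrep_in rep_in_dual)
  have "to_dual V N (J, E, i, v) = P.rep (unrep J, rep E, i, v)"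
  proof
    fix x :: "'a \<times> ('a \<Rightarrow> real) \<times> (real^'m) \<times> (real^'m)"
    obtain a' b' c' d' where x: "x = (a', b', c', d')" by (cases x)
    have "T a' \<bullet> T (unrep J) = J a'" "T (unrep b') \<bullet> T E = b' E"
      if "x \<in> product_space V N"
      using that assms by (auto simp: x product_space_def inner_unrep_rep inner_commute[of "T a'"])
    then show "to_dual V N (J, E, i, v) x = P.rep (unrep J, rep E, i, v) x"
      using assms unfolding P.rep_def to_dual_def x by simp
  qed
  then show ?thesis
    using P.rep_in_dual[OF in_P] by simp
qed

text \<open>\<open>W\<close> and \<open>A\<close> abstract the winding functional and the flux
  integral. Linearity of both follows from \<open>adjoint\<close>, which determines each of them by
  the other.\<close>

lemma dirac_structure_gyrator:
  fixes W :: "real^'m \<Rightarrow> 'a \<Rightarrow> real" and A :: "'a \<Rightarrow> real^'m"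
  assumes W: "\<And>i. W i \<in> dual V N" and adjoint: "\<And>i E. E \<in> V \<Longrightarrow> W i E = A E \<bullet> i"
  shows "dirac_structure (product_space V N) (product_norm V N)
    {((E, - J + W i, - A E - v, i), to_dual V N (J, E, i, v)) | J E i v. J \<in> dual V N \<and> E \<in> V}"
    (is "dirac_structure ?X ?n ?D")
proof -
  interpret dual: hilbert_isometry "dual V N" "dual_norm V N" "\<lambda>e. T (unrep e)"
    by (rule dual_hilbert_isometry)
  interpret P: hilbert_isometry ?X ?n "\<lambda>(a, b, c, d). (T a, T (unrep b), c, d)"
    by (rule product_hilbert_isometry)
  have dual_add: "J (E + E') = J E + J E'" if "J \<in> dual V N" "E \<in> V" "E' \<in> V" for J E E'
    using that by (simp add: dual_def)
  have dual_scaleR: "J (c *\<^sub>R E) = c * J E" if "J \<in> dual V N" "E \<in> V" for J c E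
    using that by (simp add: dual_def)
  have dual_out: "J x = 0" if "J \<in> dual V N" "x \<notin> V" for J x
    using that by (simp add: dual_def)
  have A_add: "A (E + E') = A E + A E'" if "E \<in> V" "E' \<in> V" for E E'
    using that adjoint dual_add[OF W] V_add
    by (intro vector_eq_rdot[THEN iffD1]) (simp add: inner_add_left flip: adjoint)
  have A_scaleR: "A (c *\<^sub>R E) = c *\<^sub>R A E" if "E \<in> V" for c E
    using that adjoint dual_scaleR[OF W] V_scaleR
    by (intro vector_eq_rdot[THEN iffD1]) (simp flip: adjoint)
  have W_add: "W (i + i') = W i + W i'" for i i'
  proof
    show "W (i + i') x = (W i + W i') x" for x
      by (cases "x \<in> V") (simp_all add: adjoint dual_out[OF W] inner_add_right)
  qed
  have W_scaleR: "W (c *\<^sub>R i) = c *\<^sub>R W i" for c i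
  proof
    show "W (c *\<^sub>R i) x = (c *\<^sub>R W i) x" for x
      by (cases "x \<in> V") (simp_all add: adjoint dual_out[OF W] scaleR_fun_def)
  qed
  have to_dual_add: "to_dual V N (J + J', E + E', i + i', v + v')
      = to_dual V N (J, E, i, v) + to_dual V N (J', E', i', v')"
    if "E \<in> V" "E' \<in> V" for J J' E E' and i i' v v' :: "real^'m"
    using that by (auto simp: to_dual_def fun_eq_iff product_space_def dual_add inner_add_right)
  have to_dual_scaleR: "to_dual V N (c *\<^sub>R J, c *\<^sub>R E, c *\<^sub>R i, c *\<^sub>R v) = c *\<^sub>R to_dual V N (J, E, i, v)"
    if "E \<in> V" for c J E and i v :: "real^'m"
    using that by (auto simp: to_dual_def fun_eq_iff product_space_def dual_scaleR scaleR_fun_def algebra_simps)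
  have DI: "((E, - J + W i, - A E - v, i), to_dual V N (J, E, i, v)) \<in> ?D"
    if "J \<in> dual V N" "E \<in> V" for J E i v
    using that by blast
  have f_in: "(E, - J + W i, - A E - v, i) \<in> ?X" if "J \<in> dual V N" "E \<in> V" for J E i v
    using that W by (simp add: product_space_def dual.V_diff)
  \<comment> \<open>Isotropy: the terms in \<open>J\<close>, \<open>J'\<close>, \<open>v\<close> and
    \<open>v'\<close> occur once with either sign, and \<open>adjoint\<close> cancels the
    \<open>W\<close> terms against the \<open>A\<close> terms.\<close>
  have pairing: "to_dual V N (J', E', i', v') (E, - J + W i, - A E - v, i)
      + to_dual V N (J, E, i, v) (E', - J' + W i', - A E' - v', i') = 0"
    if "J \<in> dual V N" "E \<in> V" "J' \<in> dual V N" "E' \<in> V" for J E i v J' E' i' v'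
    using that f_in[OF that(1,2)] f_in[OF that(3,4)]
    by (simp add: to_dual_def adjoint inner_diff_left inner_diff_right inner_commute)
  show ?thesis
    unfolding dirac_structure_def
  proof (intro conjI ballI P.banach)
    show "subspace ?D"
    proof (rule subspaceI)
      have "((0, - 0 + W 0, - A 0 - 0, 0), to_dual V N (0, 0, 0, 0)) \<in> ?D"
        by (rule DI) (rule dual.V_zero V_zero)+
      moreover have "W 0 = 0" "A 0 = 0" "to_dual V N (0, 0, 0, 0 :: real^'m) = 0"
        using W_scaleR[of 0 0] A_scaleR[OF V_zero, of 0] to_dual_scaleR[OF V_zero, of 0 0 0 0]
        by (simp_all add: scaleR_fun_def zero_fun_def)
      ultimately show "0 \<in> ?D" by (simp add: zero_prod_def)
    next
      fix x y assume "x \<in> ?D" "y \<in> ?D"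
      then obtain J E i v J' E' i' v' where
        x: "x = ((E, - J + W i, - A E - v, i), to_dual V N (J, E, i, v))" "J \<in> dual V N" "E \<in> V" and
        y: "y = ((E', - J' + W i', - A E' - v', i'), to_dual V N (J', E', i', v'))" "J' \<in> dual V N" "E' \<in> V"
        by auto
      have eq: "x + y = ((E + E', - (J + J') + W (i + i'), - A (E + E') - (v + v'), i + i'),
          to_dual V N (J + J', E + E', i + i', v + v'))"
        unfolding x(1) y(1) to_dual_add[OF x(3) y(3)] W_add A_add[OF x(3) y(3)] by simp
      show "x + y \<in> ?D"
        unfolding eq by (rule DI[OF dual.V_add[OF x(2) y(2)] V_add[OF x(3) y(3)]])
    next
      fix c x assume "x \<in> ?D"
      then obtain J E i v where
        x: "x = ((E, - J + W i, - A E - v, i), to_dual V N (J, E, i, v))" "J \<in> dual V N" "E \<in> V"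
        by auto
      have eq: "c *\<^sub>R x = ((c *\<^sub>R E, - (c *\<^sub>R J) + W (c *\<^sub>R i), - A (c *\<^sub>R E) - c *\<^sub>R v, c *\<^sub>R i),
          to_dual V N (c *\<^sub>R J, c *\<^sub>R E, c *\<^sub>R i, c *\<^sub>R v))"
        unfolding x(1) to_dual_scaleR[OF x(3)] W_scaleR A_scaleR[OF x(3)]
        by (simp add: scaleR_add_right scaleR_diff_right)
      show "c *\<^sub>R x \<in> ?D"
        unfolding eq by (rule DI[OF dual.V_scaleR[OF x(2)] V_scaleR[OF x(3)]])
    qed
    show "?D \<subseteq> ?X \<times> dual ?X ?n"
      using f_in to_dual_in_dual by blast
    fix f e assume "f \<in> ?X" "e \<in> dual ?X ?n"
    then obtain a b c d J E i v where f: "f = (a, b, c, d)" "a \<in> V" "b \<in> dual V N"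
      and e: "e = to_dual V N (J, E, i, v)" "J \<in> dual V N" "E \<in> V"
      using dual_eq_to_dual[of e] by (cases f) (auto simp: product_space_def)
    show "(f, e) \<in> ?D \<longleftrightarrow> (\<forall>(f', e')\<in>?D. e' f + e f' = 0)"
    proof
      assume "(f, e) \<in> ?D"
      then show "\<forall>(f', e')\<in>?D. e' f + e f' = 0"
        using pairing by fast
    next
      assume orth: "\<forall>(f', e')\<in>?D. e' f + e f' = 0"
      \<comment> \<open>Orthogonality to the element with parameters \<open>J'\<close>,
        \<open>E'\<close>, \<open>i'\<close>, \<open>v'\<close>; setting three of them to zero
        isolates one defining equation.\<close>
      have orth': "J' a + b E' + c \<bullet> i' + d \<bullet> v'
          + (J E' + (W i' E - J' E) - (A E' + v') \<bullet> i + i' \<bullet> v) = 0"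
        if "J' \<in> dual V N" "E' \<in> V" for J' E' i' v'
        using bspec[OF orth DI[OF that, of i' v']] f e f_in[OF that, of i' v'] \<open>f \<in> ?X\<close>
        by (simp add: to_dual_def inner_diff_left inner_add_left)
      have zero: "0 \<in> dual V N" "A 0 = 0" "W 0 = 0" "\<And>J. J \<in> dual V N \<Longrightarrow> J 0 = 0"
        using dual.V_zero A_scaleR[OF V_zero, of 0] W_scaleR[of 0 0] dual_scaleR[OF _ V_zero, of _ 0] by auto
      \<comment> \<open>Choosing \<open>J' = rep (a - E)\<close> turns the difference of
        \<open>J' a\<close> and \<open>J' E\<close> into a squared norm.\<close>
      have "T (a - E) \<bullet> T (a - E) = 0"
        using orth'[OF rep_in_dual[OF V_diff[OF f(2) e(3)]] V_zero, of 0 0] f(2) e(3)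
        by (simp add: zero f(3) e(2) rep_def T_diff inner_diff_left inner_diff_right inner_commute)
      then have "a = E"
        using T_eq_0[of "a - E"] V_diff f(2) e(3) by simp
      moreover have "d = i"
        using orth'[OF zero(1) V_zero, of 0]
        by (intro vector_eq_rdot[THEN iffD1]) (simp add: zero f(3) e(2) inner_commute)
      moreover have "c = - A E - v"
      proof -
        \<comment> \<open>With only \<open>i'\<close> left, orthogonality pairs
          \<open>c + v + A E\<close> with \<open>i'\<close>, which is then chosen equal to
          it.\<close>
        have "(c + v + A E) \<bullet> (c + v + A E) = 0"
          using orth'[OF zero(1) V_zero, of "c + v + A E" 0] e(3)
          by (simp add: zero f(3) e(2) adjoint inner_add_left inner_commute[of _ v])
        then show ?thesis
          by (simp add: eq_diff_eq eq_neg_iff_add_eq_0)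
      qed
      moreover have "b = - J + W i"
      proof
        fix x
        show "b x = (- J + W i) x"
        proof (cases "x \<in> V")
          case True
          then show ?thesis
            using orth'[OF zero(1) True, of 0 0] by (simp add: zero adjoint)
        qed (simp add: dual_out f(3) e(2) W)
      qed
      ultimately show "(f, e) \<in> ?D"
        using DI[OF e(2,3), of i v] by (simp add: f(1) e(1))
    qed
  qed
qed

end

section \<open>The weak curl and its domain\<close>

text \<open>On a set of finite measure the constant field \<open>e\<close> is square integrable, so
  the integrand is an inner product of two square integrable fields.\<close>

lemma integrable_l2_component:
  assumes "square_integrable f" "A \<in> lmeasurable"
  shows "integrable lebesgue (\<lambda>x. indicator A x * (f x \<bullet> e))"
proof -
  have "square_integrable (\<lambda>x. indicator A x *\<^sub>R e)"
  proof -
    have "(\<lambda>x. (norm (indicator A x *\<^sub>R e))\<^sup>2) = (\<lambda>x. (norm e)\<^sup>2 * indicator A x)"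
      by (auto simp: indicator_def)
    then show ?thesis
      using assms(2) by (auto simp: square_integrable_def fmeasurable_def intro!: integrable_real_indicator)
  qed
  from integrable_inner_square_integrable[OF assms(1) this] show ?thesis by simp
qed

text \<open>The bumps times \<open>e\<close> are test functions; they converge to the indicator of
  the box and are dominated by it.\<close>

lemma box_integral_zero_if_orthogonal_test_functions:
  fixes w :: "'b::euclidean_space l2"
  assumes orth: "\<And>\<phi>. \<phi> \<in> test_functions \<Omega> \<Longrightarrow> w \<bullet> l2_of \<phi> = 0"
    and box: "cbox a b \<subseteq> \<Omega>"
  shows "(LINT x:box a b|lebesgue. l2_fun w x \<bullet> e) = 0"
proof -
  have cont: "continuous_on UNIV (box_bump a b n)" for n
    using C_k_box_bump[of 0 a b n] by simp
  then have meas: "box_bump a b n \<in> borel_measurable lebesgue" for n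
    by (intro measurable_completion) (simp add: borel_measurable_continuous_onI)
  have int: "integrable lebesgue (\<lambda>x. indicator (box a b) x * (l2_fun w x \<bullet> e))"
    by (rule integrable_l2_component[OF square_integrable_l2_fun]) simp
  have "(\<lambda>n. LINT x|lebesgue. box_bump a b n x * (l2_fun w x \<bullet> e))
      \<longlonglongrightarrow> (LINT x|lebesgue. indicator (box a b) x * (l2_fun w x \<bullet> e))"
  proof (rule integral_dominated_convergence)
    show "integrable lebesgue (\<lambda>x. \<bar>indicator (box a b) x * (l2_fun w x \<bullet> e)\<bar>)"
      using int by (rule integrable_abs)
    show "AE x in lebesgue. norm (box_bump a b n x * (l2_fun w x \<bullet> e))
        \<le> \<bar>indicator (box a b) x * (l2_fun w x \<bullet> e)\<bar>" for n
      using box_bump_bounds[of a b n] by (auto simp: abs_mult intro!: mult_right_mono)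
  qed (use borel_measurable_integrable[OF int] in
      \<open>auto intro!: tendsto_intros box_bump_tendsto borel_measurable_times borel_measurable_inner meas l2_fun_measurable\<close>)
  moreover have "(LINT x|lebesgue. box_bump a b n x * (l2_fun w x \<bullet> e)) = 0" for n
  proof -
    have "square_integrable (\<lambda>x. box_bump a b n x *\<^sub>R e)"
      unfolding square_integrable_def
    proof
      show "integrable lebesgue (\<lambda>x. (norm (box_bump a b n x *\<^sub>R e))\<^sup>2)"
      proof (rule Bochner_Integration.integrable_bound)
        show "integrable lebesgue (\<lambda>x. indicator (box a b) x *\<^sub>R (norm e)\<^sup>2)"
          by (intro integrable_scaleR_left integrable_real_indicator)
            (use lmeasurable_box[of a b] in \<open>auto simp: fmeasurable_def\<close>)
        show "AE x in lebesgue. norm ((norm (box_bump a b n x *\<^sub>R e))\<^sup>2)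
            \<le> norm (indicator (box a b) x *\<^sub>R (norm e)\<^sup>2)"
        proof (intro AE_I2)
          fix x
          have "(box_bump a b n x)\<^sup>2 \<le> (indicator (box a b) x)\<^sup>2"
            by (intro power_mono box_bump_bounds)
          also have "\<dots> = (indicator (box a b) x :: real)" by (simp add: indicator_def)
          finally show "norm ((norm (box_bump a b n x *\<^sub>R e))\<^sup>2) \<le> norm (indicator (box a b) x *\<^sub>R (norm e)\<^sup>2)"
            by (simp add: power_mult_distrib mult_right_mono)
        qed
      qed (use meas in measurable)
    qed (use meas in measurable)
    then have "(LINT x|lebesgue. l2_fun w x \<bullet> (box_bump a b n x *\<^sub>R e)) = 0"
      using orth[OF box_bump_test_function[OF box, of n e]] by (simp add: inner_l2_of_right)
    then show ?thesis by simp
  qed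
  ultimately show ?thesis
    by (simp add: set_lebesgue_integral_def LIMSEQ_const_iff)
qed

text \<open>The argument is local: on a box whose closure lies in \<open>\<Omega>\<close> each
  component is integrable and all its box integrals vanish.\<close>

lemma l2_eq_zero_if_orthogonal_test_functions:
  fixes w :: "'b::euclidean_space l2"
  assumes "open \<Omega>" and w: "w \<in> L2_on \<Omega>"
    and orth: "\<And>\<phi>. \<phi> \<in> test_functions \<Omega> \<Longrightarrow> w \<bullet> l2_of \<phi> = 0"
  shows "w = 0"
proof -
  have local: "AE x in lebesgue. x \<in> box c d \<longrightarrow> l2_fun w x = 0" if cd: "cbox c d \<subseteq> \<Omega>" for c d
  proof -
    have "AE x in lebesgue. indicator (box c d) x * (l2_fun w x \<bullet> e) = 0" for e
    proof (rule AE_zero_if_box_integrals_zero)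
      show "integrable lebesgue (\<lambda>x. indicator (box c d) x * (l2_fun w x \<bullet> e))"
        by (rule integrable_l2_component[OF square_integrable_l2_fun]) simp
      fix a b :: "real^3"
      \<comment> \<open>Corners of the intersection of the two boxes, which again has its closed box
        inside \<open>\<Omega>\<close>.\<close>
      let ?a = "\<Sum>i\<in>Basis. max (a\<bullet>i) (c\<bullet>i) *\<^sub>R i" and ?b = "\<Sum>i\<in>Basis. min (b\<bullet>i) (d\<bullet>i) *\<^sub>R i"
      have "cbox ?a ?b \<subseteq> \<Omega>"
        using cd by (auto simp: mem_box)
      then have "(LINT x:box ?a ?b|lebesgue. l2_fun w x \<bullet> e) = 0"
        using orth by (intro box_integral_zero_if_orthogonal_test_functions)
      then show "(LINT x:box a b|lebesgue. indicator (box c d) x * (l2_fun w x \<bullet> e)) = 0"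
        unfolding set_lebesgue_integral_def
        by (simp flip: box_Int_box add: indicator_inter_arith mult.assoc)
    qed
    then have "AE x in lebesgue. \<forall>e\<in>Basis. indicator (box c d) x * (l2_fun w x \<bullet> e) = 0"
      by (intro AE_finite_allI) auto
    then show ?thesis
      by eventually_elim (auto intro: euclidean_eqI)
  qed
  define F where "F = {box c d | c d. cbox c d \<subseteq> \<Omega>}"
  \<comment> \<open>A countable subcover keeps the union of the exceptional null sets null.\<close>
  obtain F' where F': "F' \<subseteq> F" "countable F'" "\<Union>F' = \<Union>F"
    by (rule Lindelof[of F]) (auto simp: F_def)
  have "\<Omega> \<subseteq> \<Union>F"
  proof
    fix x assume "x \<in> \<Omega>"
    then obtain a b where "cbox a b \<subseteq> \<Omega>" "x \<in> box a b"
      using open_contains_cbox[OF assms(1)] by metis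
    then show "x \<in> \<Union>F" by (auto simp: F_def)
  qed
  then have sub: "\<Omega> \<subseteq> \<Union>F'" using F'(3) by simp
  have "AE x in lebesgue. \<forall>B\<in>F'. x \<in> B \<longrightarrow> l2_fun w x = 0"
    using F'(1) local by (subst AE_ball_countable[OF F'(2)]) (auto simp: F_def)
  moreover have "AE x in lebesgue. x \<notin> \<Omega> \<longrightarrow> l2_fun w x = 0"
    using w by (simp add: L2_on_def)
  ultimately have "AE x in lebesgue. l2_fun w x = l2_fun 0 x"
    using l2_fun_zero by eventually_elim (use sub in auto)
  then show ?thesis by (rule l2_eqI)
qed

section \<open>Closedness of the constraints and of the weak curl\<close>

text \<open>An orthogonal complement is at once a subspace and closed. For the converse inclusion
  \<open>u\<close> is tested with its own restriction to the complement of
  \<open>\<Omega>\<close>.\<close>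

lemma L2_on_eq_orthogonal:
  assumes "\<Omega> \<in> sets lebesgue"
  shows "L2_on \<Omega> = {u::'b::euclidean_space l2. \<forall>v\<in>L2_on (- \<Omega>). u \<bullet> v = 0}"
proof (intro set_eqI iffI CollectI ballI)
  fix u v :: "'b l2" assume "u \<in> L2_on \<Omega>" "v \<in> L2_on (- \<Omega>)"
  then have "AE x in lebesgue. x \<notin> \<Omega> \<longrightarrow> l2_fun u x = 0" "AE x in lebesgue. x \<in> \<Omega> \<longrightarrow> l2_fun v x = 0"
    by (simp_all add: L2_on_def)
  then have "AE x in lebesgue. l2_fun u x \<bullet> l2_fun v x = 0"
    by eventually_elim auto
  then show "u \<bullet> v = 0"
    unfolding inner_l2_eq by (rule integral_eq_zero_AE)
next
  fix u :: "'b l2" assume u: "u \<in> {u. \<forall>v\<in>L2_on (- \<Omega>). u \<bullet> v = 0}"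
  define f where "f x = indicator (- \<Omega>) x *\<^sub>R l2_fun u x" for x
  have mf [measurable]: "f \<in> borel_measurable lebesgue"
    unfolding f_def using assms
    by (intro borel_measurable_scaleR borel_measurable_indicator l2_fun_measurable)
      (simp add: Compl_in_sets_lebesgue)
  have f: "square_integrable f"
    unfolding square_integrable_def
  proof
    show "integrable lebesgue (\<lambda>x. (norm (f x))\<^sup>2)"
    proof (rule Bochner_Integration.integrable_bound)
      show "integrable lebesgue (\<lambda>x. (norm (l2_fun u x))\<^sup>2)"
        using square_integrable_l2_fun[of u] by (simp add: square_integrable_def)
      show "AE x in lebesgue. norm ((norm (f x))\<^sup>2) \<le> norm ((norm (l2_fun u x))\<^sup>2)"
        by (auto simp: f_def indicator_def)
    qed measurable
  qed measurable
  have "l2_of f \<in> L2_on (- \<Omega>)"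
    unfolding L2_on_def using l2_fun_l2_of[OF f] by (auto elim!: AE_mp simp: f_def)
  then have "0 = u \<bullet> l2_of f" using u by simp
  also have "\<dots> = (LINT x|lebesgue. f x \<bullet> f x)"
    unfolding inner_l2_of_right[OF f]
    by (intro Bochner_Integration.integral_cong) (auto simp: f_def indicator_def)
  finally have "(LINT x|lebesgue. f x \<bullet> f x) = 0" by simp
  then have "AE x in lebesgue. f x \<bullet> f x = 0"
    using integrable_inner_square_integrable[OF f f] by (subst (asm) integral_nonneg_eq_0_iff_AE) auto
  then have "AE x in lebesgue. x \<notin> \<Omega> \<longrightarrow> l2_fun u x = 0"
    by eventually_elim (auto simp: f_def)
  then show "u \<in> L2_on \<Omega>"
    by (simp add: L2_on_def)
qed

lemma subspace_orthogonal_set: "subspace {u. \<forall>v\<in>S. u \<bullet> v = 0}"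
  by (auto simp: subspace_def inner_add_left)

lemma closed_orthogonal_set: "closed {u. \<forall>v\<in>S. u \<bullet> v = 0}"
proof -
  have "{u. \<forall>v\<in>S. u \<bullet> v = 0} = (\<Inter>v\<in>S. {u. u \<bullet> v = 0})" by auto
  then show ?thesis
    by (auto intro!: closed_INT closed_Collect_eq continuous_intros)
qed

text \<open>The test vectors are the fields vanishing on \<open>\<Omega>\<close> together with the
  gradients of the admissible potentials.\<close>

lemma X_space_eq:
  assumes "\<Omega> \<in> sets lebesgue"
  shows "\<exists>S. X_space \<Omega> \<G> = {u. \<forall>v\<in>S. u \<bullet> v = 0}"
  unfolding X_space_def L2_on_eq_orthogonal[OF assms]
  by (rule exI[of _ "L2_on (- \<Omega>) \<union> {g. \<exists>\<psi>. \<psi> \<in> H1_0 \<Omega> \<and> has_weak_gradient \<Omega> \<psi> g \<and>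
     (\<forall>\<Gamma>\<in>\<G>. \<exists>c. has_trace \<Omega> \<Gamma> \<psi> (\<lambda>x. c))}"]) blast

text \<open>The difference is orthogonal to all test functions. Uniqueness is what gives the
  \<open>THE\<close> in \<open>weak_curl\<close> its value.\<close>

lemma weak_curl_unique:
  assumes "open \<Omega>" "has_weak_curl \<Omega> u w" "has_weak_curl \<Omega> u w'"
  shows "w = w'"
proof -
  have "subspace (L2_on \<Omega> :: (real^3) l2 set)"
    using assms(1) subspace_orthogonal_set by (subst L2_on_eq_orthogonal) auto
  then have "w - w' \<in> L2_on \<Omega>"
    using assms(2,3) by (intro subspace_diff) (auto simp: has_weak_curl_def)
  then have "w - w' = 0"
    using assms by (intro l2_eq_zero_if_orthogonal_test_functions[of \<Omega>])
      (auto simp: has_weak_curl_def inner_diff_left)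
  then show ?thesis by simp
qed

lemma weak_curl_eq: "open \<Omega> \<Longrightarrow> has_weak_curl \<Omega> u w \<Longrightarrow> weak_curl \<Omega> u = w"
  unfolding weak_curl_def using weak_curl_unique by blast

lemma subspace_has_weak_curl:
  assumes "open \<Omega>"
  shows "subspace {(u, w). has_weak_curl \<Omega> u w}"
proof -
  have "subspace (L2_on \<Omega> :: (real^3) l2 set)"
    using assms subspace_orthogonal_set by (subst L2_on_eq_orthogonal) auto
  then show ?thesis
    by (auto simp: subspace_def has_weak_curl_def inner_add_left zero_prod_def)
qed

lemma closed_has_weak_curl:
  assumes "open \<Omega>"
  shows "closed {(u, w). has_weak_curl \<Omega> u w}"
proof -
  have "closed (L2_on \<Omega> :: (real^3) l2 set)"
    using assms closed_orthogonal_set by (subst L2_on_eq_orthogonal) auto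
  moreover have "{(u, w). has_weak_curl \<Omega> u w} = L2_on \<Omega> \<times> L2_on \<Omega> \<inter>
      (\<Inter>\<phi>\<in>test_functions \<Omega>. {p. fst p \<bullet> l2_of (curl \<phi>) = snd p \<bullet> l2_of \<phi>})"
    by (auto simp: has_weak_curl_def)
  ultimately show ?thesis
    by (auto intro!: closed_Int closed_Times closed_INT closed_Collect_eq continuous_intros)
qed

text \<open>The graph of the curl over the space is cut out by linear conditions that are continuous
  in the pair, although the curl itself need not be continuous in \<open>u\<close>.\<close>

lemma X0_curl_hilbert_isometry:
  assumes "open \<Omega>"
  shows "hilbert_isometry (X0_curl \<Omega> \<G>) (H_curl_norm \<Omega>) (\<lambda>u. (u, weak_curl \<Omega> u))"
proof -
  obtain S where S: "X_space \<Omega> \<G> = {u. \<forall>v\<in>S. u \<bullet> v = 0}"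
    using X_space_eq[of \<Omega> \<G>] assms by auto
  \<comment> \<open>The second component stands for the curl of the first, so vanishing tangential
    trace becomes a closed condition; each \<open>weak_curl \<Omega> v\<close> in it is a fixed
    vector.\<close>
  let ?G = "{p. has_weak_curl \<Omega> (fst p) (snd p)} \<inter> {p. \<forall>v\<in>S. fst p \<bullet> v = 0} \<inter>
      {p. \<forall>v\<in>H1_vec \<Omega>. snd p \<bullet> v = fst p \<bullet> weak_curl \<Omega> v}"
  have G: "(u, w) \<in> ?G \<longleftrightarrow> u \<in> X0_curl \<Omega> \<G> \<and> w = weak_curl \<Omega> u" for u w
    using weak_curl_eq[OF assms] by (auto simp: X0_curl_def H0_curl_def H_curl_def S tangential_trace_def)
  have subspace: "subspace ?G"
    using subspace_has_weak_curl[OF assms]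
    by (auto simp: subspace_def inner_add_left case_prod_unfold)
  have curl: "(u, weak_curl \<Omega> u) \<in> ?G" if "u \<in> X0_curl \<Omega> \<G>" for u
    using that by (subst G) simp
  show ?thesis
  proof
    show "subspace (X0_curl \<Omega> \<G>)"
    proof (rule subspaceI)
      show "0 \<in> X0_curl \<Omega> \<G>"
        using subspace_0[OF subspace] unfolding zero_prod_def G by simp
      show "x + y \<in> X0_curl \<Omega> \<G>" if "x \<in> X0_curl \<Omega> \<G>" "y \<in> X0_curl \<Omega> \<G>" for x y
        using subspace_add[OF subspace curl[OF that(1)] curl[OF that(2)]] unfolding add_Pair G by simp
      show "c *\<^sub>R x \<in> X0_curl \<Omega> \<G>" if "x \<in> X0_curl \<Omega> \<G>" for c x
        using subspace_scale[OF subspace curl[OF that], of c] unfolding scaleR_Pair G by simp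
    qed
    show "(x + y, weak_curl \<Omega> (x + y)) = (x, weak_curl \<Omega> x) + (y, weak_curl \<Omega> y)"
      if "x \<in> X0_curl \<Omega> \<G>" "y \<in> X0_curl \<Omega> \<G>" for x y
      using subspace_add[OF subspace curl[OF that(1)] curl[OF that(2)]] unfolding add_Pair G by simp
    show "(c *\<^sub>R x, weak_curl \<Omega> (c *\<^sub>R x)) = c *\<^sub>R (x, weak_curl \<Omega> x)"
      if "x \<in> X0_curl \<Omega> \<G>" for c x
      using subspace_scale[OF subspace curl[OF that], of c] unfolding scaleR_Pair G by simp
    show "H_curl_norm \<Omega> x = norm (x, weak_curl \<Omega> x)" for x
      by (simp add: H_curl_norm_def norm_Pair)
    have "(\<lambda>u. (u, weak_curl \<Omega> u)) ` X0_curl \<Omega> \<G> = ?G"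
    proof (intro set_eqI)
      fix p :: "(real^3) l2 \<times> (real^3) l2"
      obtain u w where p: "p = (u, w)" by (cases p)
      show "p \<in> (\<lambda>u. (u, weak_curl \<Omega> u)) ` X0_curl \<Omega> \<G> \<longleftrightarrow> p \<in> ?G"
        unfolding p G by blast
    qed
    moreover have "closed ?G"
    proof -
      have "{p. \<forall>v\<in>S. fst p \<bullet> v = 0} = (\<Inter>v\<in>S. {p :: (real^3) l2 \<times> (real^3) l2. fst p \<bullet> v = 0})"
        "{p. \<forall>v\<in>H1_vec \<Omega>. snd p \<bullet> v = fst p \<bullet> weak_curl \<Omega> v}
          = (\<Inter>v\<in>H1_vec \<Omega>. {p. snd p \<bullet> v = fst p \<bullet> weak_curl \<Omega> v})"
        by auto
      then show ?thesis
        using closed_has_weak_curl[OF assms]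
        by (auto simp: case_prod_unfold intro!: closed_Int closed_INT closed_Collect_eq continuous_intros)
    qed
    ultimately show "closed ((\<lambda>u. (u, weak_curl \<Omega> u)) ` X0_curl \<Omega> \<G>)" by simp
  qed (auto simp: zero_prod_def)
qed

section \<open>The winding functional\<close>

text \<open>By completeness of Lebesgue measure, preimages that agree almost everywhere are
  measurable together.\<close>

lemma borel_measurable_lebesgue_cong_AE:
  fixes f g :: "'a::euclidean_space \<Rightarrow> 'b::topological_space"
  assumes f: "f \<in> borel_measurable lebesgue" and eq: "AE x in lebesgue. f x = g x"
  shows "g \<in> borel_measurable lebesgue"
proof (rule measurableI)
  fix B :: "'b set" assume "B \<in> sets borel"
  then have B: "f -` B \<inter> space lebesgue \<in> sets lebesgue"
    by (rule measurable_sets[OF f])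
  have "AE x in lebesgue. x \<in> f -` B \<inter> space lebesgue \<longleftrightarrow> x \<in> g -` B \<inter> space lebesgue"
    using eq by eventually_elim auto
  then show "g -` B \<inter> space lebesgue \<in> sets lebesgue"
    by (rule completion.in_sets_AE[OF _ B]) simp
qed simp

text \<open>The integrand inherits measurability and integrability from \<open>G\<close>, which is
  built from the classes \<open>u j\<close> and agrees with it almost everywhere; off
  \<open>\<Omega>\<close> both vanish with \<open>F\<close>.\<close>

lemma winding_integral:
  fixes chi :: "real^3 \<Rightarrow> real^'m^3"
  assumes u: "\<And>j. AE x in lebesgue. x \<in> \<Omega> \<longrightarrow> column j (chi x) = l2_fun (u j) x"
    and F: "F \<in> L2_on \<Omega>"
  shows "integrable lebesgue (\<lambda>x. indicator \<Omega> x *\<^sub>R (transpose (chi x) *v l2_fun F x))" (is "integrable _ ?g")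
    and "(LINT x:\<Omega>|lebesgue. transpose (chi x) *v l2_fun F x) = (\<chi> j. u j \<bullet> F)"
proof -
  define G where "G x = (\<Sum>j\<in>UNIV. (l2_fun (u j) x \<bullet> l2_fun F x) *\<^sub>R axis j (1::real))" for x
  have G_nth: "G x $ j = l2_fun (u j) x \<bullet> l2_fun F x" for x j
    by (simp add: G_def axis_def if_distrib cong: if_cong)
  have int: "integrable lebesgue (\<lambda>x. l2_fun (u j) x \<bullet> l2_fun F x)" for j
    by (intro integrable_inner_square_integrable square_integrable_l2_fun)
  then have G: "integrable lebesgue G"
    unfolding G_def by (intro Bochner_Integration.integrable_sum integrable_scaleR_left)
  have "AE x in lebesgue. \<forall>j\<in>UNIV. x \<in> \<Omega> \<longrightarrow> column j (chi x) = l2_fun (u j) x"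
    using u by (intro AE_finite_allI) auto
  moreover have "AE x in lebesgue. x \<notin> \<Omega> \<longrightarrow> l2_fun F x = 0"
    using F by (simp add: L2_on_def)
  ultimately have eq: "AE x in lebesgue. G x = ?g x"
  proof eventually_elim
    fix x assume *: "\<forall>j\<in>UNIV. x \<in> \<Omega> \<longrightarrow> column j (chi x) = l2_fun (u j) x" "x \<notin> \<Omega> \<longrightarrow> l2_fun F x = 0"
    show "G x = ?g x"
    proof (cases "x \<in> \<Omega>")
      case True
      have "(transpose (chi x) *v l2_fun F x) $ j = column j (chi x) \<bullet> l2_fun F x" for j
        by (simp add: matrix_vector_mult_def transpose_def column_def inner_vec_def)
      then show ?thesis
        using True * by (simp add: vec_eq_iff G_nth)
    next
      case False
      then have "l2_fun F x = 0" using *(2) by blast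
      with False show ?thesis by (simp add: G_def)
    qed
  qed
  have meas: "?g \<in> borel_measurable lebesgue"
    using borel_measurable_integrable[OF G] eq by (rule borel_measurable_lebesgue_cong_AE)
  show "integrable lebesgue ?g"
    using integrable_cong_AE[OF borel_measurable_integrable[OF G] meas eq] G by simp
  have "(LINT x:\<Omega>|lebesgue. transpose (chi x) *v l2_fun F x) = (LINT x|lebesgue. G x)"
    unfolding set_lebesgue_integral_def
    using integral_cong_AE[OF borel_measurable_integrable[OF G] meas eq] by simp
  also have "\<dots> = (\<chi> j. u j \<bullet> F)"
    using integral_bounded_linear[OF bounded_linear_vec_nth G, symmetric]
    by (simp add: vec_eq_iff G_nth inner_l2_eq)
  finally show "(LINT x:\<Omega>|lebesgue. transpose (chi x) *v l2_fun F x) = (\<chi> j. u j \<bullet> F)" .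
qed

text \<open>The identity holds pointwise by transposition; integrability allows the fixed vector
  \<open>i\<close> to be pulled out of the integral.\<close>

lemma winding_functional_adjoint:
  fixes chi :: "real^3 \<Rightarrow> real^'m^3"
  assumes u: "\<And>j. AE x in lebesgue. x \<in> \<Omega> \<longrightarrow> column j (chi x) = l2_fun (u j) x"
    and F: "F \<in> V" "F \<in> L2_on \<Omega>"
  shows "winding_functional \<Omega> V chi i F = (LINT x:\<Omega>|lebesgue. transpose (chi x) *v l2_fun F x) \<bullet> i"
proof -
  have "(chi x *v i) \<bullet> l2_fun F x = (transpose (chi x) *v l2_fun F x) \<bullet> i" for x
    by (metis dot_lmul_matrix inner_commute transpose_matrix_vector)
  then have "winding_functional \<Omega> V chi i F
      = (LINT x|lebesgue. (indicator \<Omega> x *\<^sub>R (transpose (chi x) *v l2_fun F x)) \<bullet> i)"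
    using F(1) by (simp add: winding_functional_def set_lebesgue_integral_def)
  also have "\<dots> = (LINT x:\<Omega>|lebesgue. transpose (chi x) *v l2_fun F x) \<bullet> i"
    unfolding set_lebesgue_integral_def
    by (rule integral_inner_left) (use winding_integral(1)[OF u F(2)] in auto)
  finally show ?thesis .
qed

lemma winding_functional_in_dual:
  fixes chi :: "real^3 \<Rightarrow> real^'m^3"
  assumes u: "\<And>j. AE x in lebesgue. x \<in> \<Omega> \<longrightarrow> column j (chi x) = l2_fun (u j) x"
    and V: "subspace V" "V \<subseteq> L2_on \<Omega>" and N: "\<And>F. F \<in> V \<Longrightarrow> norm F \<le> N F"
  shows "winding_functional \<Omega> V chi i \<in> dual V N"
proof -
  \<comment> \<open>The class that agrees with \<open>chi i\<close> almost everywhere on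
    \<open>\<Omega>\<close>; its norm is the continuity constant.\<close>
  define w where "w = (\<Sum>j\<in>UNIV. (i $ j) *\<^sub>R u j)"
  have eq: "winding_functional \<Omega> V chi i F = w \<bullet> F" if "F \<in> V" for F
  proof -
    have "F \<in> L2_on \<Omega>" using that V(2) by blast
    then show ?thesis
      unfolding winding_functional_adjoint[OF u that \<open>F \<in> L2_on \<Omega>\<close>] winding_integral(2)[OF u \<open>F \<in> L2_on \<Omega>\<close>]
      by (simp add: w_def inner_vec_def inner_sum_left mult.commute)
  qed
  have "\<bar>winding_functional \<Omega> V chi i F\<bar> \<le> norm w * N F" if "F \<in> V" for F
    unfolding eq[OF that]
    by (rule order_trans[OF Cauchy_Schwarz_ineq2]) (simp add: N[OF that] mult_left_mono)
  then show ?thesis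
    using V(1) unfolding dual_def
    by (auto simp: eq subspace_add subspace_scale inner_add_right)
      (simp add: winding_functional_def)
qed

theorem proposition1:
  fixes \<Omega> \<Omega>C \<Omega>E \<Gamma>E :: "(real^3) set" and \<Omega>I \<Gamma> :: "nat \<Rightarrow> (real^3) set" and q :: nat
    and chi :: "real^3 \<Rightarrow> real^'m^3"
  defines "V \<equiv> X0_curl \<Omega> (insert \<Gamma>E (\<Gamma> ` {1..q}))" and "N \<equiv> H_curl_norm \<Omega>"
  assumes "geometry_assumption \<Omega> \<Omega>C q \<Omega>I \<Omega>E \<Gamma> \<Gamma>E"
    and "\<And>j. \<exists>u \<in> X_space \<Omega> (insert \<Gamma>E (\<Gamma> ` {1..q})).
           AE x in lebesgue. x \<in> \<Omega> \<longrightarrow> column j (chi x) = l2_fun u x"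
  shows "dirac_structure (product_space V N) (product_norm V N) (D_MQS \<Omega> V N chi)"
proof -
  have "open \<Omega>" using assms(3) by (simp add: geometry_assumption_def)
  then interpret hilbert_isometry V N "\<lambda>u. (u, weak_curl \<Omega> u)"
    unfolding V_def N_def by (rule X0_curl_hilbert_isometry)
  interpret dual: hilbert_isometry "dual V N" "dual_norm V N" "\<lambda>e. (unrep e, weak_curl \<Omega> (unrep e))"
    by (rule dual_hilbert_isometry)
  have "\<forall>j. \<exists>u. AE x in lebesgue. x \<in> \<Omega> \<longrightarrow> column j (chi x) = l2_fun u x"
    using assms(4) by blast
  then obtain u where u: "\<And>j. AE x in lebesgue. x \<in> \<Omega> \<longrightarrow> column j (chi x) = l2_fun (u j) x"
    by (auto dest!: choice)
  have V: "V \<subseteq> L2_on \<Omega>"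
    by (auto simp: V_def X0_curl_def X_space_def)
  have W: "winding_functional \<Omega> V chi i \<in> dual V N" for i
    by (rule winding_functional_in_dual[OF u subspace V]) (auto simp: N_def H_curl_norm_def)
  \<comment> \<open>The flows are eliminated in favour of the efforts; the membership of the
    internal current in the dual is automatic, since the dual is a subspace containing
    \<open>J\<close> and the winding functional.\<close>
  have D_eq: "D_MQS \<Omega> V N chi = {((E, - J + winding_functional \<Omega> V chi i,
        - (LINT x:\<Omega>|lebesgue. transpose (chi x) *v l2_fun E x) - v, i), to_dual V N (J, E, i, v))
      | J E i v. J \<in> dual V N \<and> E \<in> V}"
    (is "_ = ?D")
  proof
    show "D_MQS \<Omega> V N chi \<subseteq> ?D"
      unfolding D_MQS_def by blast
    show "?D \<subseteq> D_MQS \<Omega> V N chi"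
    proof clarify
      fix J E i v assume "J \<in> dual V N" "E \<in> V"
      moreover from this have "- J + winding_functional \<Omega> V chi i \<in> dual V N"
        using dual.V_diff[OF W] by simp
      ultimately show "((E, - J + winding_functional \<Omega> V chi i,
          - (LINT x:\<Omega>|lebesgue. transpose (chi x) *v l2_fun E x) - v, i), to_dual V N (J, E, i, v))
          \<in> D_MQS \<Omega> V N chi"
        unfolding D_MQS_def by blast
    qed
  qed
  have adjoint: "winding_functional \<Omega> V chi i E
      = (LINT x:\<Omega>|lebesgue. transpose (chi x) *v l2_fun E x) \<bullet> i" if "E \<in> V" for i E
    using u that V by (intro winding_functional_adjoint) auto
  show ?thesis
    unfolding D_eq by (rule dirac_structure_gyrator[OF W adjoint])
qed

end
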